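(* (Generalized Hensel's lemma.) Let $\vec\gamma=(\gamma_1,\ldots,\gamma_n)\in\Gamma^n$ and let $F_1(\vec X),\ldots,F_n(\vec X)$, $\vec X=(X_1,\ldots,X_n)$, be $\vec\gamma$-polynomials with residue values $\alpha_1,\ldots,\alpha_n$. For every simple common residue root $\vec t=(t_1,\ldots,t_n)\in\mathrm{RV}^n$ of $F_1(\vec X),\ldots,F_n(\vec X)$ there is a unique $\vec a\in\mathrm{rv}^{-1}(\vec t)$ such that $F_i(\vec a)=0$ for every $i$.
   Context: We work in a (sufficiently saturated) algebraically closed, nontrivially valued field $\mathrm{VF}$ of residue characteristic $0$, with valuation $\mathrm{val}:\mathrm{VF}\to\Gamma\cup\{\infty\}$ ($\Gamma$ written additively) and maximal ideal $\mathcal M$ of the valuation ring. $\mathrm{RV}^\times=\mathrm{VF}^\times/(1+\mathcal M)$, $\mathrm{rv}$ is the quotient map extended by $\mathrm{rv}(0)=\infty$, $\mathrm{RV}=\mathrm{RV}^\times\cup\{\infty\}$, and $\mathrm{vrv}:\mathrm{RV}\to\Gamma\cup\{\infty\}$ satisfies $\mathrm{val}=\mathrm{vrv}\circ\mathrm{rv}$. These maps are applied to tuples coordinatewise; $\mathrm{rv}^{-1}(\vec t)=\prod_i\mathrm{rv}^{-1}(t_i)$. Let $\vec\gamma=(\gamma_1,\dots,\gamma_n)\in\Gamma^n$. A polynomial given as a finite sum of monomials $F(\vec X)=\sum_{\vec i j}a_{\vec i j}\vec X^{\vec i}$ with coefficients $a_{\vec ij}\in\mathrm{VF}$ (the index $j$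 allows several monomials with the same exponent $\vec i$) is a $\vec\gamma$-polynomial with residue value $\alpha\in\Gamma$ if $\alpha=\mathrm{val}(a_{\vec ij})+i_1\gamma_1+\cdots+i_n\gamma_n$ for every $\vec ij=(i_1,\ldots,i_n,j)$. For such an $F$ and $\vec t\in\mathrm{RV}^n$ with $\mathrm{vrv}(\vec t)=\vec\gamma$, $\vec t$ is a residue root of $F$ if $\mathrm{val}(F(\vec a))>\alpha$ for some (equivalently all) $\vec a\in\mathrm{rv}^{-1}(\vec t)$. If $F_1,\ldots,F_n$ are $\vec\gamma$-polynomials with residue values $\alpha_1,\dots,\alpha_n$, then $\det\partial(F_1,\ldots,F_n)/\partial\vec X$ (expanded into monomials) is a $\vec\gamma$-polynomial with residue value $\sum_i\alpha_i-\sum_i\gamma_i$. A common residue root $\vec t$ of $F_1,\ldots,F_n$ is simple if it is not a residue root of $\det\partial(F_1,\ldots,F_n)/\partial\vec X$. *)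

theory Defs
  imports "HOL-Analysis.Determinants" "HOL-Library.Extended" "HOL-Computational_Algebra.Polynomial"
begin

section \<open>Algebraically closed valued fields and RV\<close>

text \<open>
  The sort \<open>\<Gamma> \<union> {\<infinity>}\<close> is the type \<open>'g extended\<close>; its extra element \<open>Minf\<close> is never a valuation.
\<close>

definition val_max_ideal :: "('v::field \<Rightarrow> 'g::linordered_ab_group_add extended) \<Rightarrow> 'v set" where
  "val_max_ideal val = {x. Fin 0 < val x}"

locale acvf =
  fixes val :: "'v::alg_closed_field \<Rightarrow> 'g::linordered_ab_group_add extended"
  assumes val_not_Minf: "val x \<noteq> Minf"
    and val_eq_Pinf_iff: "val x = Pinf \<longleftrightarrow> x = 0"
    and val_mult: "val (x * y) = val x + val y"
    and val_add: "min (val x) (val y) \<le> val (x + y)"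
    and val_surj: "\<exists>x. val x = Fin g"
    and val_nontrivial: "\<exists>x. x \<noteq> 0 \<and> val x \<noteq> Fin 0"
    \<comment> \<open>residue characteristic 0: no positive integer vanishes in the residue field\<close>
    and residue_char_0: "n > 0 \<Longrightarrow> of_nat n \<notin> val_max_ideal val"

text \<open>
  \<open>RV\<^sup>\<times>\<close> consists of the cosets \<open>x (1 + M)\<close> with \<open>x \<noteq> 0\<close>; in \<open>RV\<close> the element \<open>\<infinity>\<close> is \<open>None\<close>.
\<close>

type_synonym 'v rv = "'v set option"

definition rv_coset :: "('v::field \<Rightarrow> 'g::linordered_ab_group_add extended) \<Rightarrow> 'v \<Rightarrow> 'v set" where
  "rv_coset val x = {x * (1 + m) | m. m \<in> val_max_ideal val}"

definition RV :: "('v::field \<Rightarrow> 'g::linordered_ab_group_add extended) \<Rightarrow> 'v rv set" where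
  "RV val = {Some (rv_coset val x) | x. x \<noteq> 0} \<union> {None}"

definition rv :: "('v::field \<Rightarrow> 'g::linordered_ab_group_add extended) \<Rightarrow> 'v \<Rightarrow> 'v rv" where
  "rv val x = (if x = 0 then None else Some (rv_coset val x))"

text \<open>The valuation is constant on each coset.\<close>

definition vrv :: "('v::field \<Rightarrow> 'g::linordered_ab_group_add extended) \<Rightarrow> 'v rv \<Rightarrow> 'g extended" where
  "vrv val t = (case t of None \<Rightarrow> Pinf | Some C \<Rightarrow> the_elem (val ` C))"

definition rv_preimage ::
  "('v::field \<Rightarrow> 'g::linordered_ab_group_add extended) \<Rightarrow> ('n \<Rightarrow> 'v rv) \<Rightarrow> ('n \<Rightarrow> 'v) set" where
  "rv_preimage val t = {a. \<forall>i. rv val (a i) = t i}"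


section \<open>Formal sums of monomials\<close>

text \<open>
  A polynomial is kept as a formal sum of monomials indexed by a set: several monomials may share
  an exponent and they are never collected.  (Collecting is not harmless: terms of equal exponent
  may partially cancel, and the property of being a \<open>\<gamma>\<close>-polynomial would be lost.)
\<close>

record ('j, 'n, 'v) monosum =
  idx :: "'j set"
  expo :: "'j \<Rightarrow> 'n \<Rightarrow> nat"
  coef :: "'j \<Rightarrow> 'v"

definition eval_ms :: "('j, 'n::finite, 'v::comm_ring_1) monosum \<Rightarrow> ('n \<Rightarrow> 'v) \<Rightarrow> 'v" where
  "eval_ms F a = (\<Sum>j\<in>idx F. coef F j * (\<Prod>k\<in>UNIV. a k ^ expo F j k))"

text \<open>Monomials not containing \<open>X\<^sub>k\<close> have derivative zero and are dropped.\<close>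

definition partial_ms ::
  "'n::finite \<Rightarrow> ('j, 'n, 'v::comm_ring_1) monosum \<Rightarrow> ('j, 'n, 'v) monosum" where
  "partial_ms k F =
    \<lparr>idx = {j \<in> idx F. expo F j k \<noteq> 0},
     expo = (\<lambda>j. (expo F j)(k := expo F j k - 1)),
     coef = (\<lambda>j. of_nat (expo F j k) * coef F j)\<rparr>"

text \<open>
  The Leibniz expansion of a determinant into monomials: one monomial for each permutation \<open>\<sigma>\<close>
  and each choice of a monomial \<open>c i\<close> in every entry \<open>(i, \<sigma> i)\<close>.
\<close>

definition det_ms ::
  "('n::finite \<Rightarrow> 'n \<Rightarrow> ('j, 'n, 'v::comm_ring_1) monosum) \<Rightarrow> (('n \<Rightarrow> 'n) \<times> ('n \<Rightarrow> 'j), 'n, 'v) monosum"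
  where
  "det_ms M =
    \<lparr>idx = {(\<sigma>, c). \<sigma> permutes UNIV \<and> (\<forall>i. c i \<in> idx (M i (\<sigma> i)))},
     expo = (\<lambda>(\<sigma>, c) k. \<Sum>i\<in>UNIV. expo (M i (\<sigma> i)) (c i) k),
     coef = (\<lambda>(\<sigma>, c). of_int (sign \<sigma>) * (\<Prod>i\<in>UNIV. coef (M i (\<sigma> i)) (c i)))\<rparr>"

definition jacobian_det_ms ::
  "('n::finite \<Rightarrow> ('j, 'n, 'v::comm_ring_1) monosum) \<Rightarrow> (('n \<Rightarrow> 'n) \<times> ('n \<Rightarrow> 'j), 'n, 'v) monosum"
  where
  "jacobian_det_ms F = det_ms (\<lambda>i k. partial_ms k (F i))"


section \<open>\<open>\<gamma>\<close>-polynomials and residue roots\<close>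

text \<open>
  The last conjunct of \<open>residue_root\<close> does not depend on the choice of \<open>a\<close>; see
  \<open>residue_root_indep\<close> below.  The inner sum in \<open>gamma_poly\<close> is the multiple \<open>i\<^sub>k \<gamma>\<^sub>k\<close> in
  the ordered group.
\<close>

definition gamma_poly ::
  "('v::field \<Rightarrow> 'g::linordered_ab_group_add extended) \<Rightarrow> ('n::finite \<Rightarrow> 'g) \<Rightarrow> 'g \<Rightarrow>
    ('j, 'n, 'v) monosum \<Rightarrow> bool" where
  "gamma_poly val \<gamma> \<alpha> F \<longleftrightarrow> finite (idx F) \<and>
    (\<forall>j\<in>idx F. Fin \<alpha> = val (coef F j) + Fin (\<Sum>k\<in>UNIV. \<Sum>l<expo F j k. \<gamma> k))"

definition residue_root ::
  "('v::field \<Rightarrow> 'g::linordered_ab_group_add extended) \<Rightarrow> ('n::finite \<Rightarrow> 'g) \<Rightarrow> 'g \<Rightarrow>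
    ('j, 'n, 'v) monosum \<Rightarrow> ('n \<Rightarrow> 'v rv) \<Rightarrow> bool" where
  "residue_root val \<gamma> \<alpha> F t \<longleftrightarrow>
    (\<forall>i. t i \<in> RV val) \<and> (\<forall>i. vrv val (t i) = Fin (\<gamma> i)) \<and>
    (\<exists>a\<in>rv_preimage val t. Fin \<alpha> < val (eval_ms F a))"

definition simple_common_residue_root ::
  "('v::field \<Rightarrow> 'g::linordered_ab_group_add extended) \<Rightarrow> ('n::finite \<Rightarrow> 'g) \<Rightarrow> ('n \<Rightarrow> 'g) \<Rightarrow>
    ('n \<Rightarrow> ('j, 'n, 'v) monosum) \<Rightarrow> ('n \<Rightarrow> 'v rv) \<Rightarrow> bool" where
  "simple_common_residue_root val \<gamma> \<alpha> F t \<longleftrightarrow>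
    (\<forall>i. residue_root val \<gamma> (\<alpha> i) (F i) t) \<and>
    \<not> residue_root val \<gamma> ((\<Sum>i\<in>UNIV. \<alpha> i) - (\<Sum>i\<in>UNIV. \<gamma> i)) (jacobian_det_ms F) t"

section \<open>Consistency of the definitions\<close>

lemma eval_det_ms:
  fixes M :: "'n::finite \<Rightarrow> 'n \<Rightarrow> ('j, 'n, 'v::comm_ring_1) monosum"
  assumes fin: "\<And>i k. finite (idx (M i k))"
  shows "eval_ms (det_ms M) a = det (\<chi> i k. eval_ms (M i k) a)"
proof -
  define m where "m \<equiv> \<lambda>i k j. coef (M i k) j * (\<Prod>l\<in>UNIV. a l ^ expo (M i k) j l)"
  have idx: "idx (det_ms M) = (SIGMA \<sigma>:{\<sigma>. \<sigma> permutes UNIV}. PiE UNIV (\<lambda>i. idx (M i (\<sigma> i))))"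
    by (auto simp: det_ms_def PiE_def Pi_def)
  have mono: "coef (det_ms M) (\<sigma>, c) * (\<Prod>l\<in>UNIV. a l ^ expo (det_ms M) (\<sigma>, c) l) =
      of_int (sign \<sigma>) * (\<Prod>i\<in>UNIV. m i (\<sigma> i) (c i))" for \<sigma> c
    unfolding m_def det_ms_def
    by (simp add: prod.distrib power_sum mult.assoc) (subst prod.swap, rule refl)
  have "eval_ms (det_ms M) a =
      (\<Sum>(\<sigma>, c)\<in>idx (det_ms M). of_int (sign \<sigma>) * (\<Prod>i\<in>UNIV. m i (\<sigma> i) (c i)))"
    unfolding eval_ms_def by (rule sum.cong) (auto simp: mono)
  also have "\<dots> = (\<Sum>\<sigma> | \<sigma> permutes UNIV. \<Sum>c\<in>PiE UNIV (\<lambda>i. idx (M i (\<sigma> i))).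
      of_int (sign \<sigma>) * (\<Prod>i\<in>UNIV. m i (\<sigma> i) (c i)))"
    unfolding idx by (subst sum.Sigma) (auto intro!: finite_PiE fin)
  also have "\<dots> = (\<Sum>\<sigma> | \<sigma> permutes UNIV. of_int (sign \<sigma>) *
      (\<Prod>i\<in>UNIV. \<Sum>j\<in>idx (M i (\<sigma> i)). m i (\<sigma> i) j))"
    by (subst prod_sum_PiE) (auto simp: fin sum_distrib_left)
  finally show ?thesis
    unfolding det_def by (simp add: m_def eval_ms_def)
qed

context acvf
begin

lemma val_0 [simp]: "val 0 = Pinf"
  by (simp add: val_eq_Pinf_iff)

lemma val_Fin: "x \<noteq> 0 \<Longrightarrow> \<exists>g. val x = Fin g"
  using val_not_Minf[of x] val_eq_Pinf_iff[of x] by (cases "val x") auto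

lemma val_1: "val 1 = Fin 0"
proof -
  obtain g where g: "val 1 = Fin g" using val_Fin[of 1] by auto
  with val_mult[of 1 1] show ?thesis by simp
qed

lemma val_minus_1: "val (- 1) = Fin 0"
proof -
  obtain g where g: "val (- 1) = Fin g" using val_Fin[of "- 1"] by auto
  with val_mult[of "- 1" "- 1"] val_1 have "g + g = 0" by simp
  hence "g = 0" by simp
  with g show ?thesis by simp
qed

lemma val_minus: "val (- x) = val x"
  using val_mult[of "- 1" x] val_minus_1 by (cases "val x") auto

lemma val_add_eq: "val x < val y \<Longrightarrow> val (x + y) = val x"
  using val_add[of x y] val_add[of "x + y" "- y"] val_minus[of y]
  by (auto simp: min_def split: if_splits)

lemma val_sum_ge: "(\<And>i. i \<in> A \<Longrightarrow> b \<le> val (f i)) \<Longrightarrow> b \<le> val (\<Sum>i\<in>A. f i)"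
proof (induction A rule: infinite_finite_induct)
  case (insert x A)
  then have "b \<le> min (val (f x)) (val (sum f A))" by simp
  also have "\<dots> \<le> val (f x + sum f A)" by (rule val_add)
  finally show ?case using insert by simp
qed auto

lemma val_of_nat: "n > 0 \<Longrightarrow> val (of_nat n) = Fin 0"
proof -
  assume "n > 0"
  then have "\<not> Fin 0 < val (of_nat n)"
    using residue_char_0 by (auto simp: val_max_ideal_def)
  moreover have "Fin 0 \<le> val (\<Sum>i<n. 1)"
    by (rule val_sum_ge) (simp add: val_1)
  ultimately show ?thesis by simp
qed

lemma val_prod:
  "(\<And>i. i \<in> A \<Longrightarrow> val (f i) = Fin (g i)) \<Longrightarrow> val (\<Prod>i\<in>A. f i) = Fin (\<Sum>i\<in>A. g i)"
  by (induction A rule: infinite_finite_induct) (auto simp: val_1 val_mult)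

lemma val_one_plus: "m \<in> val_max_ideal val \<Longrightarrow> val (1 + m) = Fin 0"
  using val_add_eq[of 1 m] by (simp add: val_1 val_max_ideal_def)

lemma val_rv_coset: "y \<in> rv_coset val x \<Longrightarrow> val y = val x"
  by (cases "val x") (auto simp: rv_coset_def val_mult val_one_plus val_not_Minf)

lemma self_in_rv_coset: "x \<in> rv_coset val x"
proof -
  have "x * (1 + 0) \<in> rv_coset val x"
    unfolding rv_coset_def val_max_ideal_def by (intro CollectI exI[of _ 0]) simp
  then show ?thesis by simp
qed

lemma vrv_rv: "vrv val (rv val x) = val x"
proof (cases "x = 0")
  case False
  have "val ` rv_coset val x = {val x}"
    using val_rv_coset self_in_rv_coset by blast
  with False show ?thesis by (simp add: vrv_def rv_def)
qed (simp add: vrv_def rv_def)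

lemma range_rv: "range (rv val) = RV val"
  by (auto simp: RV_def rv_def image_iff)

lemma one_plus_mult:
  assumes "u - 1 \<in> val_max_ideal val" "w - 1 \<in> val_max_ideal val"
  shows "u * w - 1 \<in> val_max_ideal val"
proof -
  have "val u = Fin 0" using val_one_plus[OF assms(1)] by simp
  then have "Fin 0 < val (u * (w - 1))"
    using assms(2) by (cases "val (w - 1)") (auto simp: val_mult val_max_ideal_def)
  then have "Fin 0 < val (u * (w - 1) + (u - 1))"
    using assms(1) val_add[of "u * (w - 1)" "u - 1"]
    by (auto simp: val_max_ideal_def min_def split: if_splits)
  then show ?thesis by (simp add: val_max_ideal_def algebra_simps)
qed

lemma residue_root_indep:
  assumes F: "gamma_poly val \<gamma> \<alpha> F" and t: "\<And>i. vrv val (t i) = Fin (\<gamma> i)"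
    and a: "a \<in> rv_preimage val t" and b: "b \<in> rv_preimage val t"
    and lt: "Fin \<alpha> < val (eval_ms F a)"
  shows "Fin \<alpha> < val (eval_ms F b)"
proof -
  have va: "val (a k) = Fin (\<gamma> k)" for k
    using a t[of k] vrv_rv[of "a k"] by (simp add: rv_preimage_def)
  have vb: "val (b k) = Fin (\<gamma> k)" for k
    using b t[of k] vrv_rv[of "b k"] by (simp add: rv_preimage_def)
  have nz: "a k \<noteq> 0" "b k \<noteq> 0" for k using va[of k] vb[of k] by auto
  define u where "u k = b k / a k" for k
  have U: "u k - 1 \<in> val_max_ideal val" for k
  proof -
    have "rv val (b k) = rv val (a k)" using a b by (simp add: rv_preimage_def)
    then have "rv_coset val (b k) = rv_coset val (a k)" using nz[of k] by (simp add: rv_def)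
    then have "b k \<in> rv_coset val (a k)" using self_in_rv_coset[of "b k"] by simp
    then obtain m where "m \<in> val_max_ideal val" "b k = a k * (1 + m)"
      by (auto simp: rv_coset_def)
    then show ?thesis using nz(1)[of k] by (simp add: u_def)
  qed
  have Upow: "u k ^ e - 1 \<in> val_max_ideal val" for k e
    by (induction e) (use one_plus_mult[OF U[of k]] in \<open>auto simp: val_max_ideal_def\<close>)
  have Uprod: "(\<Prod>k\<in>A. u k ^ f k) - 1 \<in> val_max_ideal val" for A f
    by (induction A rule: infinite_finite_induct)
      (auto simp: val_max_ideal_def one_plus_mult[OF Upow, unfolded val_max_ideal_def, simplified])
  define d where "d j = coef F j * (\<Prod>k\<in>UNIV. a k ^ expo F j k) *
    ((\<Prod>k\<in>UNIV. u k ^ expo F j k) - 1)" for j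
  have "Fin \<alpha> < val (d j)" if j: "j \<in> idx F" for j
  proof -
    have pow: "val (a k ^ e) = Fin (\<Sum>l<e. \<gamma> k)" for k e
      by (induction e) (simp_all add: val_1 val_mult va add.commute)
    have "val (\<Prod>k\<in>UNIV. a k ^ expo F j k) = Fin (\<Sum>k\<in>UNIV. \<Sum>l<expo F j k. \<gamma> k)"
      by (rule val_prod) (rule pow)
    moreover have "Fin \<alpha> = val (coef F j) + Fin (\<Sum>k\<in>UNIV. \<Sum>l<expo F j k. \<gamma> k)"
      using F j by (simp add: gamma_poly_def)
    ultimately have *: "val (coef F j * (\<Prod>k\<in>UNIV. a k ^ expo F j k)) = Fin \<alpha>"
      by (simp add: val_mult)
    have "Fin 0 < val ((\<Prod>k\<in>UNIV. u k ^ expo F j k) - 1)"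
      using Uprod[of "expo F j" UNIV] by (simp add: val_max_ideal_def)
    then show ?thesis
      unfolding d_def val_mult[of "_ * _"] * by (cases "val ((\<Prod>k\<in>UNIV. u k ^ expo F j k) - 1)") auto
  qed
  then have sum_gt: "Fin \<alpha> < val (sum d A)" if "A \<subseteq> idx F" for A
    using that
  proof (induction A rule: infinite_finite_induct)
    case (insert x A)
    then have "Fin \<alpha> < min (val (d x)) (val (sum d A))" by simp
    also have "\<dots> \<le> val (d x + sum d A)" by (rule val_add)
    finally show ?case using insert by simp
  qed auto
  have "b k = a k * u k" for k using nz[of k] by (simp add: u_def)
  then have "eval_ms F b = eval_ms F a + sum d (idx F)"
    unfolding eval_ms_def d_def
    by (simp add: power_mult_distrib prod.distrib sum.distrib[symmetric] algebra_simps)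
  moreover have "Fin \<alpha> < min (val (eval_ms F a)) (val (sum d (idx F)))"
    using lt sum_gt by simp
  then have "Fin \<alpha> < val (eval_ms F a + sum d (idx F))"
    using val_add by (rule order.strict_trans2)
  ultimately show ?thesis by simp
qed

lemma gamma_poly_partial:
  assumes "gamma_poly val \<gamma> \<alpha> F"
  shows "gamma_poly val \<gamma> (\<alpha> - \<gamma> k) (partial_ms k F)"
  unfolding gamma_poly_def
proof (intro conjI ballI)
  show "finite (idx (partial_ms k F))"
    using assms by (simp add: gamma_poly_def partial_ms_def)
next
  fix j assume "j \<in> idx (partial_ms k F)"
  then have j: "j \<in> idx F" and e: "expo F j k > 0" by (auto simp: partial_ms_def)
  from e obtain e' where e': "expo F j k = Suc e'" by (cases "expo F j k") auto
  let ?w = "\<lambda>f. \<Sum>k\<in>UNIV. \<Sum>l<(f k :: nat). \<gamma> k"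
  have "?w (expo F j) = (\<Sum>l<Suc e'. \<gamma> k) + (\<Sum>k\<in>UNIV - {k}. \<Sum>l<expo F j k. \<gamma> k)"
    using sum.remove[of UNIV k "\<lambda>k. \<Sum>l<expo F j k. \<gamma> k"] e' by simp
  moreover have "?w (expo (partial_ms k F) j) =
      (\<Sum>l<e'. \<gamma> k) + (\<Sum>k\<in>UNIV - {k}. \<Sum>l<expo F j k. \<gamma> k)"
    using sum.remove[of UNIV k "\<lambda>m. \<Sum>l<expo (partial_ms k F) j m. \<gamma> m"] e'
    by (simp add: partial_ms_def)
  ultimately have w: "?w (expo F j) = ?w (expo (partial_ms k F) j) + \<gamma> k"
    by (simp add: algebra_simps)
  have "Fin \<alpha> = val (coef F j) + Fin (?w (expo F j))"
    using assms j by (auto simp: gamma_poly_def)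
  moreover from this obtain g where g: "val (coef F j) = Fin g"
    by (cases "val (coef F j)") auto
  moreover have "val (coef (partial_ms k F) j) = Fin g"
    using g e val_of_nat[OF e] by (simp add: partial_ms_def val_mult)
  ultimately show "Fin (\<alpha> - \<gamma> k) =
      val (coef (partial_ms k F) j) + Fin (?w (expo (partial_ms k F) j))"
    using w by (simp add: algebra_simps)
qed

lemma gamma_poly_jacobian_det:
  assumes F: "\<And>i. gamma_poly val \<gamma> (\<alpha> i) (F i)"
  shows "gamma_poly val \<gamma> ((\<Sum>i\<in>UNIV. \<alpha> i) - (\<Sum>i\<in>UNIV. \<gamma> i)) (jacobian_det_ms F)"
  unfolding gamma_poly_def
proof (intro conjI ballI)
  define M where "M \<equiv> \<lambda>i k. partial_ms k (F i)"
  have M: "gamma_poly val \<gamma> (\<alpha> i - \<gamma> k) (M i k)" for i k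
    unfolding M_def by (rule gamma_poly_partial[OF F])
  have det: "jacobian_det_ms F = det_ms M" by (simp add: jacobian_det_ms_def M_def)
  have "idx (det_ms M) = (SIGMA \<sigma>:{\<sigma>. \<sigma> permutes UNIV}. PiE UNIV (\<lambda>i. idx (M i (\<sigma> i))))"
    by (auto simp: det_ms_def PiE_def Pi_def)
  then show "finite (idx (jacobian_det_ms F))"
    using M by (auto simp: det gamma_poly_def intro!: finite_PiE)
  fix j assume "j \<in> idx (jacobian_det_ms F)"
  then obtain \<sigma> c where j: "j = (\<sigma>, c)" and s: "\<sigma> permutes UNIV"
    and c: "\<And>i. c i \<in> idx (M i (\<sigma> i))"
    by (auto simp: det det_ms_def)
  define w where "w \<equiv> \<lambda>i. \<Sum>k\<in>UNIV. \<Sum>l<expo (M i (\<sigma> i)) (c i) k. \<gamma> k"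
  have v: "val (coef (M i (\<sigma> i)) (c i)) = Fin (\<alpha> i - \<gamma> (\<sigma> i) - w i)" for i
  proof -
    have "Fin (\<alpha> i - \<gamma> (\<sigma> i)) = val (coef (M i (\<sigma> i)) (c i)) + Fin (w i)"
      using M[of i "\<sigma> i"] c[of i] by (auto simp: gamma_poly_def w_def)
    then show ?thesis by (cases "val (coef (M i (\<sigma> i)) (c i))") auto
  qed
  have "val (of_int (sign \<sigma>)) = Fin 0"
    by (auto simp: sign_def val_1 val_minus_1)
  moreover have "(\<Sum>i\<in>UNIV. \<gamma> (\<sigma> i)) = (\<Sum>i\<in>UNIV. \<gamma> i)"
    using sum.permute[OF s, of \<gamma>] by (simp add: comp_def)
  ultimately have 1: "val (coef (det_ms M) j) =
      Fin ((\<Sum>i\<in>UNIV. \<alpha> i) - (\<Sum>i\<in>UNIV. \<gamma> i) - (\<Sum>i\<in>UNIV. w i))"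
    using val_prod[of UNIV "\<lambda>i. coef (M i (\<sigma> i)) (c i)", OF v]
    by (simp add: j det_ms_def val_mult sum_subtractf)
  have rep: "(\<Sum>l<(\<Sum>i\<in>A. f i). x) = (\<Sum>i\<in>A. \<Sum>l<f i. x)"
    for A :: "'n set" and f :: "'n \<Rightarrow> nat" and x :: 'g
  proof (induction A rule: infinite_finite_induct)
    case (insert i A)
    have "(\<Sum>l<p + q. x) = (\<Sum>l<p. x) + (\<Sum>l<q. x)" for p q :: nat
      by (induction q) (auto simp: algebra_simps)
    with insert show ?case by simp
  qed auto
  have 2: "(\<Sum>k\<in>UNIV. \<Sum>l<expo (det_ms M) j k. \<gamma> k) = (\<Sum>i\<in>UNIV. w i)"
    unfolding w_def by (simp add: j det_ms_def rep) (rule sum.swap)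
  show "Fin ((\<Sum>i\<in>UNIV. \<alpha> i) - (\<Sum>i\<in>UNIV. \<gamma> i)) = val (coef (jacobian_det_ms F) j) +
      Fin (\<Sum>k\<in>UNIV. \<Sum>l<expo (jacobian_det_ms F) j k. \<gamma> k)"
    unfolding det 1 2 by simp
qed

end

end

theory Submission
  imports Defs
begin

text \<open>
  A choice of \<open>b\<close> in \<open>rv\<^sup>-\<^sup>1(t)\<close> and the substitution \<open>a\<^sub>k = b\<^sub>k (1 + x\<^sub>k)\<close>, followed by division of
  \<open>F\<^sub>i\<close> by an element of value \<open>\<alpha>\<^sub>i\<close>, turn the problem into a polynomial system over the valuation
  ring, to be solved for \<open>x\<close> with all coordinates in the maximal ideal \<open>\<M>\<close>; the system vanishes at
  \<open>0\<close> modulo \<open>\<M>\<close>, and simplicity of the root says that its linear part there has a unit determinant.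
  Multiplication by the inverse matrix gives a polynomial map \<open>F\<close> of the polydisc \<open>\<M>\<^sup>n\<close> into itself
  that differs from the identity by a strict contraction (\<open>near_identity\<close>).  Such a map is an isometry,
  so uniqueness is immediate, and what has to be proved is that it is onto
  (\<open>near_identity_onto\<close>).

  Newton's iteration does not give this: the field need not be complete, and if the value group has
  rank greater than one the iteration need not even leave a bounded range of values.  Surjectivity has to
  come from algebraic closedness.  The components of \<open>F\<close> are switched on one at a time, starting
  from the identity map; a translation reduces a prescribed value to \<open>0\<close>.  When the \<open>n\<close>-th component is
  switched on, the map as it was before shows that the equations for the other components
  (\<open>F\<^sub>k = 0\<close>, \<open>k \<noteq> n\<close>) define a curve in the polydisc, parametrised by \<open>s = x\<^sub>n\<close>, and \<open>F\<^sub>n\<close>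
  restricts to an isometry \<open>h(s)\<close> on it.  If \<open>h\<close> has no zero, a Newton step always increases
  \<open>val (h s)\<close>.  On the other hand \<open>h\<close> is algebraic: it satisfies
  \<open>\<Sum>\<^sub>b Q\<^sub>b(s) h(s)\<^sup>b = 0\<close> with nonzero polynomials \<open>Q\<^sub>b\<close>.  Since every root of \<open>Q\<^sub>b\<close> is in the field,
  the value of \<open>Q\<^sub>b(s)\<close> becomes constant once \<open>val (h s)\<close> is large, and then two terms of the sum can
  tie only for finitely many \<open>val (h s)\<close>.  This contradiction is \<open>algebraic_isometry_has_zero\<close>.

  The algebraic equation for \<open>h\<close> comes from counting monomials: \<open>x\<^sub>n, F\<^sub>1, \<dots>, F\<^sub>n\<close> are \<open>n + 1\<close> polynomials in \<open>n\<close>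
  variables and so satisfy a nonzero polynomial relation (\<open>algebraic_dependence\<close>).  Putting \<open>F\<^sub>k = 0\<close>
  in it might make it trivial; but before that one can divide by the largest
  possible power of \<open>F\<^sub>k\<close>, because the quotient still vanishes where \<open>F\<^sub>k \<noteq> 0\<close>, and by continuity it
  vanishes where \<open>F\<^sub>k = 0\<close> too (\<open>relation_specialise\<close>).
\<close>

section \<open>Algebraic dependence of polynomial functions\<close>

text \<open>
  Gaussian elimination, one equation of the system at a time.
\<close>

lemma underdetermined_system_nontrivial_solution:
  fixes A :: "'i \<Rightarrow> 'j \<Rightarrow> 'v::field"
  assumes "finite J" "finite I" "card J < card I"
  shows "\<exists>p. (\<exists>i\<in>I. p i \<noteq> 0) \<and> (\<forall>j\<in>J. (\<Sum>i\<in>I. p i * A i j) = 0)"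
  using assms
proof (induction J arbitrary: I A rule: finite_induct)
  case empty
  then have "I \<noteq> {}" by auto
  then show ?case by (intro exI[of _ "\<lambda>_. 1"]) auto
next
  case (insert j J)
  show ?case
  proof (cases "\<forall>i\<in>I. A i j = 0")
    case True
    with insert.IH[of I A] insert.prems insert.hyps show ?thesis by auto
  next
    case False
    then obtain i0 where i0: "i0 \<in> I" "A i0 j \<noteq> 0" by auto
    define I' where "I' = I - {i0}"
    define A' where "A' i l = A i l - A i j / A i0 j * A i0 l" for i l
    have "card J < card I'" "finite I'"
      using insert.prems insert.hyps i0 by (auto simp: I'_def)
    from insert.IH[OF this(2,1), of A'] obtain p
      where p: "\<exists>i\<in>I'. p i \<noteq> 0" "\<And>l. l \<in> J \<Longrightarrow> (\<Sum>i\<in>I'. p i * A' i l) = 0" by blast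
    define p0 where "p0 = - (\<Sum>i\<in>I'. p i * A i j) / A i0 j"
    define p' where "p' = p(i0 := p0)"
    have sum: "(\<Sum>i\<in>I. p' i * A i l) = p0 * A i0 l + (\<Sum>i\<in>I'. p i * A i l)" for l
      using insert.prems i0
      by (subst sum.remove[of I i0]) (auto simp: p'_def I'_def intro!: sum.cong)
    have "(\<Sum>i\<in>I. p' i * A i l) = 0" if "l \<in> insert j J" for l
    proof (cases "l = j")
      case True
      then show ?thesis unfolding sum p0_def using i0 by simp
    next
      case False
      have "0 = (\<Sum>i\<in>I'. p i * A' i l)" using p(2) that False by simp
      also have "\<dots> = (\<Sum>i\<in>I'. p i * A i l - p i * A i j * (A i0 l / A i0 j))"
        by (simp add: A'_def algebra_simps)
      also have "\<dots> = (\<Sum>i\<in>I'. p i * A i l) - (\<Sum>i\<in>I'. p i * A i j) * (A i0 l / A i0 j)"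
        by (simp add: sum_subtractf sum_distrib_right sum_divide_distrib)
      also have "\<dots> = (\<Sum>i\<in>I. p' i * A i l)" unfolding sum p0_def by simp
      finally show ?thesis by simp
    qed
    moreover have "\<exists>i\<in>I. p' i \<noteq> 0"
      using p(1) by (auto simp: p'_def I'_def)
    ultimately show ?thesis by blast
  qed
qed

definition exponent_box :: "nat \<Rightarrow> ('n::finite \<Rightarrow> nat) set" where
  "exponent_box D = {e. \<forall>k. e k \<le> D}"

lemma exponent_box_eq_PiE: "exponent_box D = PiE UNIV (\<lambda>_. {..D})"
  by (auto simp: exponent_box_def PiE_def)

lemma finite_exponent_box [simp]: "finite (exponent_box D)"
  by (simp add: exponent_box_eq_PiE finite_PiE)

lemma card_exponent_box: "card (exponent_box D :: ('n::finite \<Rightarrow> nat) set) = Suc D ^ CARD('n)"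
  by (simp add: exponent_box_eq_PiE card_PiE)

text \<open>
  Degrees are bounded in each variable separately, not in total, so that the monomials of bounded
  degree form a box whose size is a plain power.
\<close>

definition poly_fun :: "nat \<Rightarrow> (('n::finite \<Rightarrow> 'v::comm_ring_1) \<Rightarrow> 'v) \<Rightarrow> bool" where
  "poly_fun D f \<longleftrightarrow> (\<exists>c. \<forall>x. f x = (\<Sum>e\<in>exponent_box D. c e * (\<Prod>k\<in>UNIV. x k ^ e k)))"

lemma poly_fun_monomial:
  assumes "\<And>k. e k \<le> D"
  shows "poly_fun D (\<lambda>x. \<Prod>k\<in>UNIV. x k ^ e k)"
  unfolding poly_fun_def
proof (intro exI[of _ "\<lambda>e'. if e' = e then 1 else 0"] allI)
  fix x :: "'a \<Rightarrow> 'b"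
  have "e \<in> exponent_box D" using assms by (simp add: exponent_box_def)
  then show "(\<Prod>k\<in>UNIV. x k ^ e k) =
      (\<Sum>e'\<in>exponent_box D. (if e' = e then 1 else 0) * (\<Prod>k\<in>UNIV. x k ^ e' k))"
    by (simp add: if_distrib[of "\<lambda>u. u * _"] cong: if_cong)
qed

lemma poly_fun_scale:
  assumes "poly_fun D f"
  shows "poly_fun D (\<lambda>x. c * f x)"
proof -
  from assms obtain a where "\<And>x. f x = (\<Sum>e\<in>exponent_box D. a e * (\<Prod>k\<in>UNIV. x k ^ e k))"
    unfolding poly_fun_def by blast
  then show ?thesis unfolding poly_fun_def
    by (intro exI[of _ "\<lambda>e. c * a e"]) (simp add: sum_distrib_left mult.assoc)
qed

lemma poly_fun_add:
  assumes "poly_fun D f" "poly_fun D g"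
  shows "poly_fun D (\<lambda>x. f x + g x)"
proof -
  from assms obtain a b where
    "\<And>x. f x = (\<Sum>e\<in>exponent_box D. a e * (\<Prod>k\<in>UNIV. x k ^ e k))"
    "\<And>x. g x = (\<Sum>e\<in>exponent_box D. b e * (\<Prod>k\<in>UNIV. x k ^ e k))"
    unfolding poly_fun_def by blast
  then show ?thesis unfolding poly_fun_def
    by (intro exI[of _ "\<lambda>e. a e + b e"]) (simp add: sum.distrib distrib_right)
qed

lemma poly_fun_const: "poly_fun D (\<lambda>x. c)"
  using poly_fun_scale[OF poly_fun_monomial[of "\<lambda>_. 0" D], of c] by simp

lemma poly_fun_sum:
  "(\<And>i. i \<in> A \<Longrightarrow> poly_fun D (f i)) \<Longrightarrow> poly_fun D (\<lambda>x. \<Sum>i\<in>A. f i x)"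
  by (induction A rule: infinite_finite_induct) (auto intro: poly_fun_const poly_fun_add)

lemma poly_fun_weaken:
  assumes "poly_fun D f" "D \<le> D'"
  shows "poly_fun D' f"
proof -
  from assms obtain a where "f = (\<lambda>x. \<Sum>e\<in>exponent_box D. a e * (\<Prod>k\<in>UNIV. x k ^ e k))"
    unfolding poly_fun_def by blast
  moreover have "poly_fun D' (\<lambda>x. \<Sum>e\<in>exponent_box D. a e * (\<Prod>k\<in>UNIV. x k ^ e k))"
    using assms(2)
    by (intro poly_fun_sum poly_fun_scale poly_fun_monomial) (auto simp: exponent_box_def intro: order_trans)
  ultimately show ?thesis by simp
qed

lemma poly_fun_mult:
  assumes "poly_fun D f" "poly_fun D' g"
  shows "poly_fun (D + D') (\<lambda>x. f x * g x)"
proof -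
  from assms obtain a b where
    ab: "\<And>x. f x = (\<Sum>e\<in>exponent_box D. a e * (\<Prod>k\<in>UNIV. x k ^ e k))"
    "\<And>x. g x = (\<Sum>e\<in>exponent_box D'. b e * (\<Prod>k\<in>UNIV. x k ^ e k))"
    unfolding poly_fun_def by blast
  have "f x * g x = (\<Sum>e\<in>exponent_box D. \<Sum>e'\<in>exponent_box D'. a e * (b e' * (\<Prod>k\<in>UNIV. x k ^ (e k + e' k))))"
    for x
    unfolding ab sum_product by (simp add: power_add prod.distrib mult_ac)
  moreover have "poly_fun (D + D') (\<lambda>x. \<Sum>e\<in>exponent_box D. \<Sum>e'\<in>exponent_box D'.
      a e * (b e' * (\<Prod>k\<in>UNIV. x k ^ (e k + e' k))))"
    by (intro poly_fun_sum poly_fun_scale poly_fun_monomial) (auto simp: exponent_box_def add_mono)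
  ultimately show ?thesis by simp
qed

lemma poly_fun_coordinate: "poly_fun 1 (\<lambda>x. x k)"
proof -
  have "(\<Prod>l\<in>UNIV. x l ^ (if l = k then 1 else 0)) = x k" for x :: "'a \<Rightarrow> 'b"
    by (simp add: if_distrib[of "\<lambda>u. _ ^ u"] cong: if_cong)
  then show ?thesis using poly_fun_monomial[of "\<lambda>l. if l = k then 1 else 0" 1, where ?'b = 'b] by auto
qed

lemma poly_fun_power: "poly_fun D f \<Longrightarrow> poly_fun (m * D) (\<lambda>x. f x ^ m)"
proof (induction m)
  case (Suc m)
  then show ?case using poly_fun_mult[of D f "m * D" "\<lambda>x. f x ^ m"] by simp
qed (simp add: poly_fun_const)

lemma poly_fun_prod:
  "(\<And>i. i \<in> A \<Longrightarrow> poly_fun (D i) (f i)) \<Longrightarrow> poly_fun (\<Sum>i\<in>A. D i) (\<lambda>x. \<Prod>i\<in>A. f i x)"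
  by (induction A rule: infinite_finite_induct) (auto intro: poly_fun_const poly_fun_mult)

text \<open>
  A relation is indexed by pairs \<open>(i, e)\<close> standing for \<open>f\<^sup>i \<Prod>\<^sub>k F\<^sub>k\<^bsup>e k\<^esup>\<close>.  With all \<open>n + 1\<close> exponents
  at most \<open>N\<close> there are more than \<open>N\<^sup>n\<^sup>+\<^sup>1\<close> such products, but they lie in a space whose dimension grows
  only like \<open>N\<^sup>n\<close>.
\<close>

lemma algebraic_dependence:
  fixes f :: "('n::finite \<Rightarrow> 'v::field) \<Rightarrow> 'v" and F :: "('n \<Rightarrow> 'v) \<Rightarrow> 'n \<Rightarrow> 'v"
  assumes f: "poly_fun D f" and F: "\<And>k. poly_fun D (\<lambda>x. F x k)"
  shows "\<exists>S p. finite S \<and> S \<noteq> {} \<and> (\<forall>m\<in>S. p m \<noteq> 0) \<and>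
    (\<forall>x. (\<Sum>m\<in>S. p m * (f x ^ fst m * (\<Prod>k\<in>UNIV. F x k ^ snd m k))) = 0)"
proof -
  define n where "n = CARD('n)"
  \<comment> \<open>A product with exponents at most \<open>N\<close> has degree at most \<open>E\<close> in each variable; this \<open>N\<close> is large
    enough for \<open>(E + 1)\<^sup>n \<le> N\<^sup>n\<^sup>+\<^sup>1 < (N + 1)\<^sup>n\<^sup>+\<^sup>1\<close>.\<close>
  define N where "N = Suc (Suc n * D) ^ n"
  define E where "E = (n + 1) * D * N"
  define I :: "(nat \<times> ('n \<Rightarrow> nat)) set" where "I = {..N} \<times> exponent_box N"
  define T where "T m x = f x ^ fst m * (\<Prod>k\<in>UNIV. F x k ^ snd m k)" for m x
  have "poly_fun E (T m)" if "m \<in> I" for m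
  proof -
    have le: "fst m \<le> N" "snd m k \<le> N" for k
      using that by (auto simp: I_def exponent_box_def)
    have "poly_fun (fst m * D + (\<Sum>k\<in>UNIV. snd m k * D)) (T m)"
      unfolding T_def by (intro poly_fun_mult poly_fun_power poly_fun_prod f F)
    moreover have "fst m * D + (\<Sum>k\<in>UNIV. snd m k * D) \<le> N * D + (\<Sum>k\<in>(UNIV :: 'n set). N * D)"
      by (intro add_mono sum_mono mult_right_mono le) auto
    moreover have "N * D + (\<Sum>k\<in>(UNIV :: 'n set). N * D) = E"
      by (simp add: E_def n_def algebra_simps)
    ultimately show ?thesis using poly_fun_weaken by metis
  qed
  then have "\<forall>m\<in>I. \<exists>c. \<forall>x. T m x = (\<Sum>e\<in>exponent_box E. c e * (\<Prod>k\<in>UNIV. x k ^ e k))"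
    unfolding poly_fun_def by blast
  then obtain A where
    A: "\<And>m x. m \<in> I \<Longrightarrow> T m x = (\<Sum>e\<in>exponent_box E. A m e * (\<Prod>k\<in>UNIV. x k ^ e k))"
    by metis
  have "N \<ge> 1" unfolding N_def by simp
  then have "Suc E \<le> Suc (Suc n * D) * N" unfolding E_def by (simp add: algebra_simps)
  then have "Suc E ^ n \<le> (Suc (Suc n * D) * N) ^ n" by (rule power_mono) simp
  also have "\<dots> = N * N ^ n" unfolding power_mult_distrib N_def[symmetric] ..
  also have "\<dots> < Suc N * Suc N ^ n"
    by (intro mult_less_le_imp_less power_mono) (use \<open>N \<ge> 1\<close> in auto)
  finally have "card (exponent_box E :: ('n \<Rightarrow> nat) set) < card I"
    by (simp add: I_def card_exponent_box card_cartesian_product n_def)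
  moreover have "finite I" by (simp add: I_def)
  ultimately obtain p where p: "\<exists>m\<in>I. p m \<noteq> 0"
      "\<And>e. e \<in> exponent_box E \<Longrightarrow> (\<Sum>m\<in>I. p m * A m e) = 0"
    using underdetermined_system_nontrivial_solution[of "exponent_box E" I A] by auto
  define S where "S = {m \<in> I. p m \<noteq> 0}"
  have "(\<Sum>m\<in>S. p m * T m x) = 0" for x
  proof -
    have "(\<Sum>m\<in>S. p m * T m x) = (\<Sum>m\<in>I. p m * T m x)"
      using \<open>finite I\<close> by (intro sum.mono_neutral_left) (auto simp: S_def)
    also have "\<dots> = (\<Sum>m\<in>I. \<Sum>e\<in>exponent_box E. p m * A m e * (\<Prod>k\<in>UNIV. x k ^ e k))"
      by (simp add: A sum_distrib_left mult.assoc)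
    also have "\<dots> = (\<Sum>e\<in>exponent_box E. (\<Sum>m\<in>I. p m * A m e) * (\<Prod>k\<in>UNIV. x k ^ e k))"
      by (subst sum.swap) (simp add: sum_distrib_right)
    also have "\<dots> = 0" using p(2) by simp
    finally show ?thesis .
  qed
  then show ?thesis
    using p(1) \<open>finite I\<close> unfolding T_def
    by (intro exI[of _ S] exI[of _ p]) (auto simp: S_def)
qed

section \<open>Valuations of sums and algebraic isometries of the maximal ideal\<close>

text \<open>
  Ordered groups are torsion free.
\<close>

lemma multiple_inj:
  fixes v w :: "'g::linordered_ab_group_add" and n :: nat
  assumes "n > 0" "(\<Sum>l<n. v) = (\<Sum>l<n. w)"
  shows "v = w"
proof (rule ccontr)
  have mono: "(\<Sum>l<n. a) < (\<Sum>l<n. b)" if "a < b" for a b :: 'g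
    using assms(1) that by (intro sum_strict_mono) auto
  assume "v \<noteq> w"
  then show False using mono[of v w] mono[of w v] assms(2) by force
qed

lemma det_scale_rows_columns:
  fixes E :: "'n::finite \<Rightarrow> 'n \<Rightarrow> 'v::comm_ring_1"
  shows "det (\<chi> i k. u i * v k * E i k) = (\<Prod>i\<in>UNIV. u i) * (\<Prod>k\<in>UNIV. v k) * det (\<chi> i k. E i k)"
proof -
  have "(\<Prod>i\<in>UNIV. v (\<sigma> i)) = (\<Prod>k\<in>UNIV. v k)" if "\<sigma> permutes UNIV" for \<sigma>
    using prod.permute[OF that, of v] by (simp add: comp_def)
  then show ?thesis
    unfolding det_def sum_distrib_left
    by (intro sum.cong) (simp_all add: prod.distrib mult_ac)
qed

context acvf
begin

lemma positive_value_exists: "\<exists>\<delta>::'g. 0 < \<delta>"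
proof -
  obtain x where x: "x \<noteq> 0" "val x \<noteq> Fin 0" using val_nontrivial by blast
  then obtain g where "val x = Fin g" using val_Fin by blast
  with x have "0 < g \<or> 0 < - g" by auto
  then show ?thesis by blast
qed

text \<open>
  If \<open>v\<close> is finite it serves as \<open>g\<close>; for \<open>v = \<infinity>\<close> the value group has to be nontrivial.
\<close>

lemma value_between:
  assumes "u \<noteq> Minf" "u < v"
  shows "\<exists>g::'g. u < Fin g \<and> Fin g \<le> v"
proof (cases v)
  case (Fin b)
  with assms show ?thesis by auto
next
  case Pinf
  with assms obtain a where a: "u = Fin a" by (cases u) auto
  obtain \<delta> :: 'g where "0 < \<delta>" using positive_value_exists by blast
  with a Pinf show ?thesis by (intro exI[of _ "a + \<delta>"]) simp
qed (use assms in auto)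

lemma eq_if_same_finite_lower_bounds:
  assumes "u \<noteq> Minf" "v \<noteq> Minf" "\<And>g::'g. Fin g \<le> u \<longleftrightarrow> Fin g \<le> v"
  shows "u = v"
proof (rule ccontr)
  assume "u \<noteq> v"
  then consider "u < v" | "v < u" by fastforce
  then show False
    using value_between[of u v] value_between[of v u] assms by cases (auto simp: not_le[symmetric])
qed

lemma val_diff_commute: "val (x - y) = val (y - x)"
  using val_minus[of "x - y"] by simp

lemma val_add_gt: "b < val x \<Longrightarrow> b < val y \<Longrightarrow> b < val (x + y)"
  using val_add[of x y] by (auto simp: min_def split: if_splits)

lemma val_add_ge: "b \<le> val x \<Longrightarrow> b \<le> val y \<Longrightarrow> b \<le> val (x + y)"
  using val_add[of x y] by (auto simp: min_def split: if_splits)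

lemma val_diff_ge: "b \<le> val x \<Longrightarrow> b \<le> val y \<Longrightarrow> b \<le> val (x - y)"
  using val_add_ge[of b x "- y"] by (simp add: val_minus)

lemma val_diff_gt: "b < val x \<Longrightarrow> b < val y \<Longrightarrow> b < val (x - y)"
  using val_add_gt[of b x "- y"] by (simp add: val_minus)

lemma val_sum_gt:
  assumes "b \<noteq> Pinf" "\<And>i. i \<in> A \<Longrightarrow> b < val (f i)"
  shows "b < val (\<Sum>i\<in>A. f i)"
proof -
  have "b < Pinf" using assms(1) by (cases b) auto
  then show ?thesis using assms(2)
    by (induction A rule: infinite_finite_induct) (auto intro: val_add_gt)
qed

lemma val_power: "val x = Fin g \<Longrightarrow> val (x ^ b) = Fin (\<Sum>l<b. g)"
  by (induction b) (simp_all add: val_1 val_mult add.commute)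

text \<open>
  The term of least value dominates the others.
\<close>

lemma sum_distinct_vals_nonzero:
  assumes "finite B" "B \<noteq> {}" "\<And>b. b \<in> B \<Longrightarrow> f b \<noteq> 0" "inj_on (\<lambda>b. val (f b)) B"
  shows "(\<Sum>b\<in>B. f b) \<noteq> 0"
proof -
  have "Min ((\<lambda>b. val (f b)) ` B) \<in> (\<lambda>b. val (f b)) ` B" using assms by (intro Min_in) auto
  then obtain b where b: "b \<in> B" "val (f b) = Min ((\<lambda>b. val (f b)) ` B)" by (metis imageE)
  have "val (f b) < val (f c)" if "c \<in> B - {b}" for c
  proof -
    have "val (f b) \<le> val (f c)" using b(2) that assms(1) by simp
    moreover have "val (f b) \<noteq> val (f c)" using assms(4) b(1) that by (auto simp: inj_on_def)
    ultimately show ?thesis by simp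
  qed
  then have "val (f b) < val (\<Sum>c\<in>B - {b}. f c)"
    using assms(3)[OF b(1)] by (intro val_sum_gt) (auto simp: val_eq_Pinf_iff)
  then have "val (f b + (\<Sum>c\<in>B - {b}. f c)) = val (f b)" by (rule val_add_eq)
  moreover have "(\<Sum>b\<in>B. f b) = f b + (\<Sum>c\<in>B - {b}. f c)"
    using b(1) assms(1) by (rule sum.remove[rotated])
  ultimately show ?thesis using assms(3)[OF b(1)] by (metis val_eq_Pinf_iff)
qed

text \<open>
  Suppose that \<open>h\<close> has no zero.  The balls \<open>{s. val (h s\<^sub>0) \<le> val (s - s\<^sub>0)}\<close> form a chain, and by
  \<open>improve\<close> no element of the field is in all of them.  So a root \<open>r\<close> of some \<open>Q\<^sub>b\<close> drops out
  at some stage, from which on \<open>val (s - r)\<close> is constant; after finitely many roots, so are the values of all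
  \<open>Q\<^sub>b(s)\<close>.  In a vanishing sum two terms \<open>Q\<^sub>b(s) h(s)\<^sup>b\<close> have the same value, and because the
  value group is torsion free this determines \<open>val (h s)\<close> up to finitely many
  possibilities.  The largest of them that occurs contradicts \<open>improve\<close>.
\<close>

lemma algebraic_isometry_has_zero:
  fixes h :: "'v \<Rightarrow> 'v" and Q :: "nat \<Rightarrow> 'v poly"
  defines "\<M> \<equiv> val_max_ideal val"
  assumes maps: "\<And>s. s \<in> \<M> \<Longrightarrow> h s \<in> \<M>"
    and iso: "\<And>s s'. s \<in> \<M> \<Longrightarrow> s' \<in> \<M> \<Longrightarrow> val (h s - h s') = val (s - s')"
    and improve: "\<And>s. s \<in> \<M> \<Longrightarrow> h s \<noteq> 0 \<Longrightarrow> \<exists>s'\<in>\<M>. val (h s) < val (h s')"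
    and B: "finite B" "B \<noteq> {}" "\<And>b. b \<in> B \<Longrightarrow> Q b \<noteq> 0"
    and rel: "\<And>s. s \<in> \<M> \<Longrightarrow> (\<Sum>b\<in>B. poly (Q b) s * h s ^ b) = 0"
  shows "\<exists>s\<in>\<M>. h s = 0"
proof (rule ccontr)
  assume "\<not> ?thesis"
  then have nz: "h s \<noteq> 0" if "s \<in> \<M>" for s using that by blast
  have zero: "0 \<in> \<M>" by (simp add: \<M>_def val_max_ideal_def)
  \<comment> \<open>\<open>E P\<close>: the property \<open>P\<close> holds for all \<open>s\<close> with \<open>val (h s)\<close> large enough.\<close>
  define E where "E P \<longleftrightarrow> (\<exists>s0\<in>\<M>. \<forall>s\<in>\<M>. val (h s0) \<le> val (h s) \<longrightarrow> P s)" for P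
  have E_conj: "E (\<lambda>s. P s \<and> P' s)" if P: "E P" "E P'" for P P'
  proof -
    from P obtain s0 s1 where s: "s0 \<in> \<M>" "s1 \<in> \<M>"
      "\<And>s. s \<in> \<M> \<Longrightarrow> val (h s0) \<le> val (h s) \<Longrightarrow> P s"
      "\<And>s. s \<in> \<M> \<Longrightarrow> val (h s1) \<le> val (h s) \<Longrightarrow> P' s"
      unfolding E_def by blast
    show ?thesis
    proof (cases "val (h s0) \<le> val (h s1)")
      case True
      then show ?thesis unfolding E_def using s by (intro bexI[of _ s1]) (auto intro: order_trans)
    next
      case False
      then show ?thesis unfolding E_def using s by (intro bexI[of _ s0]) (auto intro: order_trans)
    qed
  qed
  have E_mono: "E P'" if "E P" "\<And>s. s \<in> \<M> \<Longrightarrow> P s \<Longrightarrow> P' s" for P P'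
    using that unfolding E_def by blast
  \<comment> \<open>For \<open>r\<close> in \<open>\<M>\<close>, improving \<open>h r\<close> leads out of reach of \<open>r\<close>, since \<open>h\<close> is an isometry.\<close>
  have away: "\<exists>s0\<in>\<M>. val (s0 - r) < val (h s0)" for r
  proof (cases "r \<in> \<M>")
    case True
    then obtain s where s: "s \<in> \<M>" "val (h r) < val (h s)" using improve nz by blast
    have "val (s - r) = val (h r - h s)" using iso[OF s(1) True] val_diff_commute by metis
    also have "\<dots> = val (h r)" using val_add_eq[of "h r" "- h s"] s(2) by (simp add: val_minus)
    finally show ?thesis using s by (intro bexI[of _ s]) simp_all
  next
    case False
    then have "val r \<le> Fin 0" by (simp add: \<M>_def val_max_ideal_def)
    also have "Fin 0 < val (h 0)" using maps[OF zero] by (simp add: \<M>_def val_max_ideal_def)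
    finally show ?thesis using zero by (intro bexI[of _ 0]) (auto simp: val_minus)
  qed
  have root: "\<exists>g. E (\<lambda>s. val (s - r) = Fin g)" for r
  proof -
    obtain s0 where s0: "s0 \<in> \<M>" "val (s0 - r) < val (h s0)" using away by blast
    have "val (s - r) = val (s0 - r)" if s: "s \<in> \<M>" "val (h s0) \<le> val (h s)" for s
    proof -
      have "val (h s0) \<le> val (h s - h s0)" using s(2) by (intro val_diff_ge) auto
      also have "\<dots> = val (s - s0)" using iso s s0 by blast
      finally have "val ((s0 - r) + (s - s0)) = val (s0 - r)"
        using s0(2) by (intro val_add_eq) simp
      then show ?thesis by simp
    qed
    moreover have "\<exists>g. val (s0 - r) = Fin g"
      using s0(2) val_not_Minf[of "s0 - r"] by (cases "val (s0 - r)") auto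
    ultimately show ?thesis using s0(1) unfolding E_def by metis
  qed
  have const: "\<exists>q. E (\<lambda>s. val (poly P s) = Fin q)" if "P \<noteq> 0" for P
    using that
  proof (induction "degree P" arbitrary: P rule: less_induct)
    case less
    show ?case
    proof (cases "degree P = 0")
      case True
      then obtain c where c: "P = [:c:]" by (rule degree_eq_zeroE)
      with less.prems obtain q where "val c = Fin q" using val_Fin by fastforce
      then have "E (\<lambda>s. val (poly P s) = Fin q)" using zero by (auto simp: E_def c)
      then show ?thesis by blast
    next
      case False
      then obtain r where "poly P r = 0" using alg_closed_imp_poly_has_root by blast
      then obtain P' where P': "P = [:- r, 1:] * P'" by (metis poly_eq_0_iff_dvd dvdE)
      then have "P' \<noteq> 0" using less.prems by auto
      then have "degree P' < degree P" unfolding P' by (subst degree_mult_eq) auto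
      then obtain q where "E (\<lambda>s. val (poly P' s) = Fin q)" using less.hyps \<open>P' \<noteq> 0\<close> by blast
      moreover obtain g where "E (\<lambda>s. val (s - r) = Fin g)" using root by blast
      ultimately have "E (\<lambda>s. val (s - r) = Fin g \<and> val (poly P' s) = Fin q)" by (intro E_conj)
      then have "E (\<lambda>s. val (poly P s) = Fin (g + q))"
        by (rule E_mono) (simp add: P' val_mult del: mult_pCons_left)
      then show ?thesis by blast
    qed
  qed
  from const B(3) have "\<forall>b\<in>B. \<exists>q. E (\<lambda>s. val (poly (Q b) s) = Fin q)" by blast
  then obtain q where q: "\<And>b. b \<in> B \<Longrightarrow> E (\<lambda>s. val (poly (Q b) s) = Fin (q b))" by metis
  have "E (\<lambda>s. \<forall>b\<in>B. val (poly (Q b) s) = Fin (q b))"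
    using B(1) q
  proof (induction B rule: finite_induct)
    case empty
    then show ?case using zero by (auto simp: E_def)
  next
    case (insert b B)
    then have "E (\<lambda>s. val (poly (Q b) s) = Fin (q b) \<and> (\<forall>b\<in>B. val (poly (Q b) s) = Fin (q b)))"
      by (intro E_conj) auto
    then show ?case by (rule E_mono) auto
  qed
  then obtain s0 where s0: "s0 \<in> \<M>" and vQ: "\<And>s b. s \<in> \<M> \<Longrightarrow> val (h s0) \<le> val (h s) \<Longrightarrow> b \<in> B \<Longrightarrow>
      val (poly (Q b) s) = Fin (q b)"
    unfolding E_def by blast
  \<comment> \<open>\<open>V\<close> collects the solutions \<open>v\<close> of \<open>q b + b v = q b' + b' v\<close> for \<open>b < b'\<close>, at most one for each pair.\<close>
  define V where "V = (\<Union>b\<in>B. \<Union>b'\<in>B. if b < b' then {v. (\<Sum>l<b'-b. v) = q b - q b'} else {})"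
  have "finite {v. (\<Sum>l<n. v) = g}" if "n > 0" for n :: nat and g :: 'g
  proof (cases "\<exists>w. (\<Sum>l<n. w) = g")
    case True
    then obtain w where "(\<Sum>l<n. w) = g" by blast
    then have "{v. (\<Sum>l<n. v) = g} \<subseteq> {w}" using multiple_inj[OF that] by auto
    then show ?thesis using finite_subset by blast
  qed simp
  then have "finite V" using B(1) by (auto simp: V_def)
  have inV: "\<exists>v\<in>V. val (h s) = Fin v" if s: "s \<in> \<M>" "val (h s0) \<le> val (h s)" for s
  proof -
    obtain v where v: "val (h s) = Fin v" using nz[OF s(1)] val_Fin by blast
    have val_term: "val (poly (Q b) s * h s ^ b) = Fin (q b + (\<Sum>l<b. v))" if "b \<in> B" for b
      using vQ[OF s that] val_power[OF v] by (simp add: val_mult)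
    have "poly (Q b) s * h s ^ b \<noteq> 0" if "b \<in> B" for b
      using val_term[OF that] by (metis extended.distinct(1) val_0)
    then have "\<not> inj_on (\<lambda>b. val (poly (Q b) s * h s ^ b)) B"
      using sum_distinct_vals_nonzero[of B "\<lambda>b. poly (Q b) s * h s ^ b"] B rel[OF s(1)] by blast
    then obtain b b' where "b \<in> B" "b' \<in> B" "b \<noteq> b'"
        "q b + (\<Sum>l<b. v) = q b' + (\<Sum>l<b'. v)"
      unfolding inj_on_def using val_term by auto
    then obtain b b' where b: "b \<in> B" "b' \<in> B" "b < b'"
        "q b + (\<Sum>l<b. v) = q b' + (\<Sum>l<b'. v)"
      by (metis linorder_neqE_nat)
    have "(\<Sum>l<b'. v) = (\<Sum>l<b. v) + (\<Sum>l<b'-b. v)"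
    proof -
      have "(\<Sum>l<b+d. v) = (\<Sum>l<b. v) + (\<Sum>l<d. v)" for d
        by (induction d) (auto simp: algebra_simps)
      from this[of "b' - b"] show ?thesis using b(3) by simp
    qed
    with b(4) have "(\<Sum>l<b'-b. v) = q b - q b'" by (simp add: algebra_simps)
    then have "v \<in> V" using b(1-3) unfolding V_def by auto
    then show ?thesis using v by blast
  qed
  define W where "W = {v \<in> V. \<exists>s\<in>\<M>. val (h s) = Fin v \<and> val (h s0) \<le> val (h s)}"
  have "finite W" using \<open>finite V\<close> by (simp add: W_def)
  moreover have "W \<noteq> {}" using inV[OF s0] s0 by (auto simp: W_def)
  ultimately have "Max W \<in> W" and max: "\<And>v. v \<in> W \<Longrightarrow> v \<le> Max W" by auto
  then obtain s where s: "s \<in> \<M>" "val (h s) = Fin (Max W)" "val (h s0) \<le> val (h s)"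
    by (auto simp: W_def)
  obtain s' where s': "s' \<in> \<M>" "val (h s) < val (h s')" using improve[OF s(1) nz[OF s(1)]] by blast
  moreover have le: "val (h s0) \<le> val (h s')" using s(3) s'(2) by simp
  ultimately obtain v where "v \<in> V" "val (h s') = Fin v" using inV by blast
  then have "v \<in> W" using s'(1) le by (auto simp: W_def)
  then show False using max[of v] s'(2) s(2) \<open>val (h s') = Fin v\<close> by simp
qed

section \<open>Maps of the polydisc that are close to the identity\<close>

abbreviation max_ideal :: "'v set" where
  "max_ideal \<equiv> val_max_ideal val"

lemma max_ideal_iff: "x \<in> max_ideal \<longleftrightarrow> Fin 0 < val x"
  by (simp add: val_max_ideal_def)

lemma zero_in_max_ideal [simp]: "0 \<in> max_ideal"
  by (simp add: max_ideal_iff)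

lemma max_ideal_add: "x \<in> max_ideal \<Longrightarrow> y \<in> max_ideal \<Longrightarrow> x + y \<in> max_ideal"
  by (simp add: max_ideal_iff val_add_gt)

lemma max_ideal_diff: "x \<in> max_ideal \<Longrightarrow> y \<in> max_ideal \<Longrightarrow> x - y \<in> max_ideal"
  by (simp add: max_ideal_iff val_diff_gt)

lemma val_mult_ge: "Fin g \<le> val x \<Longrightarrow> Fin h \<le> val y \<Longrightarrow> Fin (g + h) \<le> val (x * y)"
  by (cases "val x"; cases "val y") (auto simp: val_mult add_mono)

lemma val_mult_gt: "Fin g < val x \<Longrightarrow> Fin h \<le> val y \<Longrightarrow> Fin (g + h) < val (x * y)"
  by (cases "val x"; cases "val y") (auto simp: val_mult add_less_le_mono)

lemma val_mult_integral: "Fin 0 \<le> val x \<Longrightarrow> Fin h \<le> val y \<Longrightarrow> Fin h \<le> val (x * y)"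
  using val_mult_ge[of 0 x h y] by simp

text \<open>
  Congruence modulo \<open>{x. g \<le> val x}\<close>; integrality is built in because products respect
  the congruence only for integral elements.
\<close>

definition integral_cong :: "'g \<Rightarrow> 'v \<Rightarrow> 'v \<Rightarrow> bool" where
  "integral_cong g u v \<longleftrightarrow> Fin 0 \<le> val u \<and> Fin 0 \<le> val v \<and> Fin g \<le> val (u - v)"

lemma integral_cong_refl: "Fin 0 \<le> val u \<Longrightarrow> integral_cong g u u"
  by (simp add: integral_cong_def)

lemma integral_cong_mult:
  assumes "integral_cong g u v" "integral_cong g u' v'"
  shows "integral_cong g (u * u') (v * v')"
proof -
  have "Fin g \<le> val (u * (u' - v') + v' * (u - v))"
    using assms by (intro val_add_ge val_mult_integral) (auto simp: integral_cong_def)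
  moreover have "u * (u' - v') + v' * (u - v) = u * u' - v * v'" by (simp add: algebra_simps)
  ultimately show ?thesis using assms by (auto simp: integral_cong_def intro: val_mult_integral)
qed

lemma integral_cong_power: "integral_cong g u v \<Longrightarrow> integral_cong g (u ^ m) (v ^ m)"
  by (induction m) (auto intro: integral_cong_mult integral_cong_refl simp: val_1)

lemma integral_cong_prod:
  "(\<And>k. k \<in> A \<Longrightarrow> integral_cong g (u k) (v k)) \<Longrightarrow> integral_cong g (\<Prod>k\<in>A. u k) (\<Prod>k\<in>A. v k)"
  by (induction A rule: infinite_finite_induct)
    (auto intro: integral_cong_mult integral_cong_refl simp: val_1)

lemma integral_cong_sum:
  assumes "\<And>k. k \<in> A \<Longrightarrow> integral_cong g (u k) (v k)"
  shows "integral_cong g (\<Sum>k\<in>A. u k) (\<Sum>k\<in>A. v k)"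
  using assms unfolding integral_cong_def sum_subtractf[symmetric] by (auto intro: val_sum_ge)

definition polydisc :: "('n \<Rightarrow> 'v) set" where
  "polydisc = {x. \<forall>k. x k \<in> max_ideal}"

lemma polydiscD: "x \<in> polydisc \<Longrightarrow> x k \<in> max_ideal"
  by (simp add: polydisc_def)

text \<open>
  On differences, \<open>F\<close> agrees with the identity up to an error of strictly larger value than
  the largest common lower bound \<open>g\<close> of the coordinates.  Stating this for every lower bound \<open>g\<close>
  avoids naming the minimum, which is \<open>\<infinity>\<close> when \<open>x = y\<close>.
\<close>

definition near_identity :: "(('n::finite \<Rightarrow> 'v) \<Rightarrow> ('n \<Rightarrow> 'v)) \<Rightarrow> bool" where
  "near_identity F \<longleftrightarrow> (\<forall>x\<in>polydisc. F x \<in> polydisc) \<and>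
    (\<forall>x\<in>polydisc. \<forall>y\<in>polydisc. \<forall>g. (\<forall>k. Fin g \<le> val (x k - y k)) \<longrightarrow>
      (\<forall>k. Fin g < val ((F x k - F y k) - (x k - y k))))"

lemma near_identity_maps: "near_identity F \<Longrightarrow> x \<in> polydisc \<Longrightarrow> F x \<in> polydisc"
  by (simp add: near_identity_def)

lemma near_identityD:
  assumes "near_identity F" "x \<in> polydisc" "y \<in> polydisc" "\<And>k. Fin g \<le> val (x k - y k)"
  shows "Fin g < val ((F x k - F y k) - (x k - y k))"
  using assms unfolding near_identity_def by blast

text \<open>
  At a coordinate where \<open>x - y\<close> has its least value, the error is too small to change that value.
\<close>

lemma near_identity_isometry:
  fixes F :: "('n::finite \<Rightarrow> 'v) \<Rightarrow> ('n \<Rightarrow> 'v)"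
  assumes F: "near_identity F" and x: "x \<in> polydisc" and y: "y \<in> polydisc"
  shows "(\<forall>k. Fin g \<le> val (F x k - F y k)) \<longleftrightarrow> (\<forall>k. Fin g \<le> val (x k - y k))"
proof
  assume le: "\<forall>k. Fin g \<le> val (x k - y k)"
  show "\<forall>k. Fin g \<le> val (F x k - F y k)"
  proof
    fix k
    have "Fin g \<le> val ((F x k - F y k) - (x k - y k))"
      using near_identityD[OF F x y, of g k] le by simp
    then have "Fin g \<le> val (((F x k - F y k) - (x k - y k)) + (x k - y k))"
      using le by (intro val_add_ge) auto
    then show "Fin g \<le> val (F x k - F y k)" by simp
  qed
next
  assume le: "\<forall>k. Fin g \<le> val (F x k - F y k)"
  define m where "m = Min (range (\<lambda>k. val (x k - y k)))"
  have m: "m \<le> val (x k - y k)" for k unfolding m_def by (intro Min_le) auto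
  have "m \<in> range (\<lambda>k. val (x k - y k))" unfolding m_def by (intro Min_in) auto
  then obtain l where l: "m = val (x l - y l)" by blast
  have "Fin g \<le> m"
  proof (cases m)
    case (Fin h)
    then have "val (x l - y l) < val ((F x l - F y l) - (x l - y l))"
      using near_identityD[OF F x y, of h l] m l by simp
    from val_add_eq[OF this] have "val (F x l - F y l) = m" using l by simp
    then show ?thesis using le by metis
  qed (use l val_not_Minf in auto)
  then show "\<forall>k. Fin g \<le> val (x k - y k)" using m order_trans by blast
qed

lemma near_identity_inj:
  assumes F: "near_identity F" and x: "x \<in> polydisc" and y: "y \<in> polydisc" and eq: "F x = F y"
  shows "x = (y :: 'n::finite \<Rightarrow> 'v)"
proof
  fix k
  have "Fin g \<le> val (x k - y k)" for g
    using near_identity_isometry[OF F x y, of g] eq by simp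
  then have "val (x k - y k) = Pinf" by (intro eq_if_same_finite_lower_bounds) (auto simp: val_not_Minf)
  then show "x k = y k" by (simp add: val_eq_Pinf_iff)
qed

lemma near_identity_translate:
  assumes F: "near_identity F" and w: "w \<in> polydisc"
  shows "near_identity (\<lambda>x k. F x k - w k)"
  using F w unfolding near_identity_def by (auto simp: polydisc_def max_ideal_diff)

text \<open>
  Switching off some of the components of \<open>F\<close>, by which surjectivity is later proved one
  component at a time.
\<close>

lemma near_identity_restrict:
  fixes F :: "('n::finite \<Rightarrow> 'v) \<Rightarrow> ('n \<Rightarrow> 'v)"
  assumes F: "near_identity F"
  shows "near_identity (\<lambda>x k. if k \<in> I then F x k else x k)"
  unfolding near_identity_def
proof (intro conjI ballI allI impI)
  fix x :: "'n \<Rightarrow> 'v" assume "x \<in> polydisc"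
  then show "(\<lambda>k. if k \<in> I then F x k else x k) \<in> polydisc"
    using near_identity_maps[OF F, of x] by (auto simp: polydisc_def)
next
  fix x y :: "'n \<Rightarrow> 'v" and g k
  assume "x \<in> polydisc" "y \<in> polydisc" "\<forall>k. Fin g \<le> val (x k - y k)"
  then show "Fin g < val ((if k \<in> I then F x k else x k) - (if k \<in> I then F y k else y k) - (x k - y k))"
    using near_identityD[OF F, of x y g k] by auto
qed

section \<open>Surjectivity of polynomial maps close to the identity\<close>

lemma integral_multiple_exists:
  assumes "finite S"
  shows "\<exists>d. d \<noteq> 0 \<and> (\<forall>m\<in>S. Fin 0 \<le> val (d * p m))"
  using assms
proof (induction S rule: finite_induct)
  case empty
  then show ?case by (intro exI[of _ 1]) simp
next
  case (insert m S)
  then obtain d where d: "d \<noteq> 0" "\<And>m. m \<in> S \<Longrightarrow> Fin 0 \<le> val (d * p m)" by blast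
  obtain c where c: "c \<noteq> 0" "Fin 0 \<le> val c" "Fin 0 \<le> val (c * (d * p m))"
  proof (cases "val (d * p m)")
    case (Fin g)
    obtain c where "val c = Fin (max 0 (- g))" using val_surj by blast
    moreover from this have "c \<noteq> 0" by auto
    moreover have "0 \<le> max 0 (- g) + g"
      using add_right_mono[of "- g" "max 0 (- g)" g] by simp
    ultimately show ?thesis using that[of c] Fin by (simp add: val_mult)
  next
    case Pinf
    then show ?thesis using that[of 1] by (simp add: val_1)
  qed (simp add: val_not_Minf)
  have "Fin 0 \<le> val (c * d * p l)" if "l \<in> insert m S" for l
    using that c d(2) val_mult_integral[of c 0 "d * p l"] by (auto simp: mult.assoc)
  then show ?case using c(1) d(1) by (intro exI[of _ "c * d"]) auto
qed

text \<open>
  The slice is the set where the components \<open>F\<^sub>k\<close> with \<open>k \<in> A\<close> vanish.  In the relation their factors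
  are already gone, but the exponents in \<open>S\<close> are left as they are; so the family \<open>p\<close> of
  coefficients stays the same while \<open>S\<close> shrinks.
\<close>

definition relation_on_slice ::
  "'n::finite \<Rightarrow> (('n \<Rightarrow> 'v) \<Rightarrow> ('n \<Rightarrow> 'v)) \<Rightarrow> (nat \<times> ('n \<Rightarrow> nat) \<Rightarrow> 'v) \<Rightarrow> 'n set \<Rightarrow>
    (nat \<times> ('n \<Rightarrow> nat)) set \<Rightarrow> bool" where
  "relation_on_slice n F p A S \<longleftrightarrow> (\<forall>x\<in>polydisc. (\<forall>k\<in>A. F x k = 0) \<longrightarrow>
    (\<Sum>m\<in>S. p m * (x n ^ fst m * (\<Prod>k\<in>- A. F x k ^ snd m k))) = 0)"

text \<open>
  Every monomial of the relation is divisible by \<open>F\<^sub>k\<^sup>K\<close>.  The quotient \<open>T\<close> vanishes on the part of the slice where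
  \<open>F\<^sub>k \<noteq> 0\<close>.  A point \<open>x\<close> with \<open>F\<^sub>k x = 0\<close> is a limit of such points inside the slice: prescribe
  the value \<open>c\<close> of \<open>F\<^sub>k\<close>, keep the other components and \<open>x\<^sub>n\<close>, and let \<open>c\<close> tend
  to \<open>0\<close>.  At \<open>x\<close> only the monomials with exponent exactly \<open>K\<close> survive in \<open>T\<close>.
\<close>

lemma relation_specialise:
  fixes F :: "('n::finite \<Rightarrow> 'v) \<Rightarrow> ('n \<Rightarrow> 'v)"
  assumes F: "near_identity F"
    and onto: "\<And>w. w \<in> polydisc \<Longrightarrow> \<exists>x\<in>polydisc. (F x)(n := x n) = w"
    and S: "finite S" and p: "\<And>m. m \<in> S \<Longrightarrow> Fin 0 \<le> val (p m)"
    and rel: "relation_on_slice n F p A S"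
    and k: "k \<notin> A" "k \<noteq> n" "n \<notin> A"
    and K: "\<And>m. m \<in> S \<Longrightarrow> K \<le> snd m k"
  shows "relation_on_slice n F p (insert k A) {m \<in> S. snd m k = K}"
  unfolding relation_on_slice_def
proof (intro ballI impI)
  fix x :: "'n \<Rightarrow> 'v" assume x: "x \<in> polydisc" and zero: "\<forall>j\<in>insert k A. F x j = 0"
  define G where "G y = (F y)(n := y n)" for y
  have G_eq: "G = (\<lambda>y j. if j \<in> - {n} then F y j else y j)" by (auto simp: G_def fun_eq_iff)
  have G: "near_identity G" unfolding G_eq by (rule near_identity_restrict[OF F])
  define T where "T y = (\<Sum>m\<in>S. p m * (y n ^ fst m *
      ((\<Prod>j\<in>- insert k A. F y j ^ snd m j) * F y k ^ (snd m k - K))))" for y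
  have split: "(\<Prod>j\<in>- A. f j) = (\<Prod>j\<in>- insert k A. f j) * f k" for f :: "'n \<Rightarrow> 'v"
  proof -
    have "- A = insert k (- insert k A)" using k(1) by auto
    then show ?thesis by (metis ComplD finite insertI1 mult.commute prod.insert)
  qed
  have T0: "T y = 0" if y: "y \<in> polydisc" "\<forall>j\<in>A. F y j = 0" "F y k \<noteq> 0" for y
  proof -
    have "F y k ^ K * T y = (\<Sum>m\<in>S. p m * (y n ^ fst m * (\<Prod>j\<in>- A. F y j ^ snd m j)))"
      unfolding T_def sum_distrib_left
    proof (rule sum.cong)
      fix m assume "m \<in> S"
      then have "F y k ^ snd m k = F y k ^ K * F y k ^ (snd m k - K)"
        using K by (simp flip: power_add)
      then show "F y k ^ K * (p m * (y n ^ fst m * ((\<Prod>j\<in>- insert k A. F y j ^ snd m j) *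
            F y k ^ (snd m k - K)))) = p m * (y n ^ fst m * (\<Prod>j\<in>- A. F y j ^ snd m j))"
        unfolding split by (simp only: mult_ac)
    qed simp
    also have "\<dots> = 0" using rel y unfolding relation_on_slice_def by blast
    finally show ?thesis using y(3) by simp
  qed
  have cong: "integral_cong g (T x) (T y)"
    if y: "y \<in> polydisc" and close: "\<And>j. Fin g \<le> val (x j - y j)" for y g
  proof -
    have int: "Fin 0 \<le> val (z j)" if "z \<in> polydisc" for z :: "'n \<Rightarrow> 'v" and j
      using polydiscD[OF that, of j] by (simp add: max_ideal_iff)
    have "integral_cong g (F x j) (F y j)" for j
      using near_identity_isometry[OF F x y, of g] close
      by (simp add: integral_cong_def int near_identity_maps F x y)
    moreover have "integral_cong g (x n) (y n)"
      using close by (simp add: integral_cong_def int x y)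
    ultimately show ?thesis unfolding T_def
      by (intro integral_cong_sum integral_cong_mult integral_cong_power integral_cong_prod
          integral_cong_refl p)
  qed
  have "T x = 0"
  proof (rule ccontr)
    assume "T x \<noteq> 0"
    then obtain g where g: "val (T x) = Fin g" using val_Fin by blast
    obtain \<delta> :: 'g where \<delta>: "0 < \<delta>" using positive_value_exists by blast
    \<comment> \<open>A value beyond that of \<open>T x\<close>, and positive so that \<open>c\<close> lies in \<open>\<M>\<close>.\<close>
    define h where "h = max g 0 + \<delta>"
    have h: "g < h" "0 < h" using \<delta> by (auto simp: h_def intro: add_strict_increasing2 le_less_trans
          simp: less_add_same_cancel1 max_def)
    obtain c where c: "val c = Fin h" using val_surj by blast
    then have "c \<in> max_ideal" "c \<noteq> 0" using h by (auto simp: max_ideal_iff)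
    then have "(G x)(k := c) \<in> polydisc"
      using near_identity_maps[OF G x] by (auto simp: polydisc_def)
    then obtain y where y: "y \<in> polydisc" "G y = (G x)(k := c)"
      using onto unfolding G_def by blast
    have Gk: "G x k = 0" using zero k by (simp add: G_def)
    have "\<forall>j. Fin h \<le> val (G x j - G y j)"
      using c by (auto simp: y(2) Gk val_minus)
    then have close: "\<And>j. Fin h \<le> val (x j - y j)"
      using near_identity_isometry[OF G x y(1)] by blast
    have "F y j = 0" if "j \<in> A" for j
    proof -
      have "G y j = G x j" using that k y(2) by auto
      moreover have "j \<noteq> n" using that k(3) by blast
      ultimately show ?thesis using that zero by (simp add: G_def)
    qed
    moreover have "F y k = c" using fun_cong[OF y(2), of k] k by (simp add: G_def)
    ultimately have "T y = 0" using T0[OF y(1)] \<open>c \<noteq> 0\<close> by simp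
    then have "Fin h \<le> Fin g" using cong[OF y(1) close] g by (simp add: integral_cong_def)
    then show False using h(1) by (simp add: not_le[symmetric])
  qed
  have "(\<Sum>m\<in>{m \<in> S. snd m k = K}. p m * (x n ^ fst m * (\<Prod>j\<in>- insert k A. F x j ^ snd m j))) = T x"
    unfolding T_def
  proof (rule sum.mono_neutral_cong_left[OF S])
    show "\<forall>m\<in>S - {m \<in> S. snd m k = K}. p m * (x n ^ fst m *
        ((\<Prod>j\<in>- insert k A. F x j ^ snd m j) * F x k ^ (snd m k - K))) = 0"
      using K zero by (force simp: power_0_left)
  qed auto
  then show "(\<Sum>m\<in>{m \<in> S. snd m k = K}. p m * (x n ^ fst m *
      (\<Prod>j\<in>- insert k A. F x j ^ snd m j))) = 0"
    using \<open>T x = 0\<close> by simp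
qed

text \<open>
  Specialising the components other than \<open>F\<^sub>n\<close> to \<open>0\<close> one after another, each time keeping only the monomials
  of least exponent, leaves a nonempty set of monomials whose exponents agree except for those of \<open>x\<^sub>n\<close> and
  \<open>F\<^sub>n\<close>.  No cancellation can therefore occur when they are collected by powers of \<open>F\<^sub>n\<close>.
\<close>

lemma plane_relation_on_curve:
  fixes F :: "('n::finite \<Rightarrow> 'v) \<Rightarrow> ('n \<Rightarrow> 'v)"
  assumes F: "near_identity F" and poly: "\<And>k. poly_fun D (\<lambda>x. F x k)"
    and onto: "\<And>w. w \<in> polydisc \<Longrightarrow> \<exists>x\<in>polydisc. (F x)(n := x n) = w"
  shows "\<exists>B Q. finite B \<and> B \<noteq> {} \<and> (\<forall>b\<in>B. Q b \<noteq> 0) \<and>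
    (\<forall>x\<in>polydisc. (\<forall>k. k \<noteq> n \<longrightarrow> F x k = 0) \<longrightarrow>
      (\<Sum>b\<in>B. poly (Q b) (x n) * F x n ^ b) = 0)"
proof -
  have "\<And>k. poly_fun (D + 1) (\<lambda>x. F x k)" "poly_fun (D + 1) (\<lambda>x. x n)"
    using poly_fun_weaken[OF poly, of "D + 1"] poly_fun_weaken[OF poly_fun_coordinate, of "D + 1"]
    by auto
  from algebraic_dependence[where F = F, OF this(2,1)] obtain S0 p0 where
    S0: "finite S0" "S0 \<noteq> {}" "\<And>m. m \<in> S0 \<Longrightarrow> p0 m \<noteq> 0" and
    rel0: "\<And>x. (\<Sum>m\<in>S0. p0 m * (x n ^ fst m * (\<Prod>k\<in>UNIV. F x k ^ snd m k))) = 0"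
    by blast
  obtain d where d: "d \<noteq> 0" "\<And>m. m \<in> S0 \<Longrightarrow> Fin 0 \<le> val (d * p0 m)"
    using integral_multiple_exists[OF S0(1), of p0] by blast
  define p where "p m = d * p0 m" for m
  have "relation_on_slice n F p {} S0"
    using rel0 unfolding relation_on_slice_def p_def
    by (simp add: mult.assoc flip: sum_distrib_left)
  have "\<exists>S\<subseteq>S0. S \<noteq> {} \<and> relation_on_slice n F p A S \<and> (\<forall>k\<in>A. \<forall>m\<in>S. \<forall>m'\<in>S. snd m k = snd m' k)"
    if "n \<notin> A" for A
    using finite[of A] that
  proof (induction A rule: finite_induct)
    case empty
    then show ?case using S0(2) \<open>relation_on_slice n F p {} S0\<close> by auto
  next
    case (insert k A)
    then obtain S where S: "S \<subseteq> S0" "S \<noteq> {}" "relation_on_slice n F p A S"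
      "\<forall>k\<in>A. \<forall>m\<in>S. \<forall>m'\<in>S. snd m k = snd m' k" by auto
    have finS: "finite S" using S(1) S0(1) finite_subset by blast
    define K where "K = Min ((\<lambda>m. snd m k) ` S)"
    have K: "K \<le> snd m k" if "m \<in> S" for m using that finS by (simp add: K_def)
    have "K \<in> (\<lambda>m. snd m k) ` S" unfolding K_def using finS S(2) by (intro Min_in) auto
    then obtain m where "m \<in> S" "K = snd m k" by blast
    then have ne: "{m \<in> S. snd m k = K} \<noteq> {}" by blast
    have "relation_on_slice n F p (insert k A) {m \<in> S. snd m k = K}"
      using relation_specialise[OF F onto finS _ S(3) _ _ _ K] insert.hyps insert.prems S(1) d(2)
      by (auto simp: p_def)
    moreover have "\<forall>l\<in>insert k A. \<forall>m\<in>{m \<in> S. snd m k = K}. \<forall>m'\<in>{m \<in> S. snd m k = K}. snd m l = snd m' l"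
      using S(4) by blast
    ultimately show ?case using ne S(1)
      by (intro exI[of _ "{m \<in> S. snd m k = K}"]) blast
  qed
  from this[of "- {n}"] obtain S where S: "S \<subseteq> S0" "S \<noteq> {}" "relation_on_slice n F p (- {n}) S"
      "\<forall>k\<in>- {n}. \<forall>m\<in>S. \<forall>m'\<in>S. snd m k = snd m' k" by auto
  have finS: "finite S" using S(1) S0(1) finite_subset by blast
  have inj: "m = m'" if "m \<in> S" "m' \<in> S" "fst m = fst m'" "snd m n = snd m' n" for m m'
  proof -
    have "snd m k = snd m' k" for k
      using that(4) bspec[OF S(4), of k] that(1,2) by (cases "k = n") blast+
    then show ?thesis using that(3) by (simp add: prod_eq_iff fun_eq_iff)
  qed
  define B where "B = (\<lambda>m. snd m n) ` S"
  define Q where "Q b = (\<Sum>m\<in>{m \<in> S. snd m n = b}. monom (p m) (fst m))" for b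
  have "Q b \<noteq> 0" if "b \<in> B" for b
  proof -
    from that obtain m where m: "m \<in> S" "snd m n = b" by (auto simp: B_def)
    have "coeff (Q b) (fst m) = (\<Sum>m'\<in>{m \<in> S. snd m n = b}. if m' = m then p m else 0)"
      unfolding Q_def coeff_sum
    proof (rule sum.cong)
      fix m' assume "m' \<in> {m \<in> S. snd m n = b}"
      then have m': "m' \<in> S" "snd m' n = snd m n" using m(2) by simp_all
      show "coeff (monom (p m') (fst m')) (fst m) = (if m' = m then p m else 0)"
      proof (cases "fst m' = fst m")
        case True
        then have "m' = m" using m'(2) by (intro inj[OF m'(1) m(1)])
        then show ?thesis by simp
      qed auto
    qed simp
    also have "\<dots> = p m" using m finS by (simp add: sum.delta)
    also have "p m \<noteq> 0" using S0(3)[of m] m(1) S(1) d(1) by (auto simp: p_def)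
    finally show ?thesis by auto
  qed
  moreover have "(\<Sum>b\<in>B. poly (Q b) (x n) * F x n ^ b) = 0"
    if x: "x \<in> polydisc" "\<forall>k. k \<noteq> n \<longrightarrow> F x k = 0" for x
  proof -
    have "(\<Sum>b\<in>B. poly (Q b) (x n) * F x n ^ b) =
        (\<Sum>b\<in>B. \<Sum>m\<in>{m \<in> S. snd m n = b}. p m * (x n ^ fst m * F x n ^ snd m n))"
      unfolding Q_def poly_sum sum_distrib_right
      by (intro sum.cong) (auto simp: poly_monom)
    also have "\<dots> = (\<Sum>m\<in>S. p m * (x n ^ fst m * F x n ^ snd m n))"
      unfolding B_def by (rule sum.image_gen[OF finS, symmetric])
    also have "\<dots> = 0" using S(3) x unfolding relation_on_slice_def by auto
    finally show ?thesis .
  qed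
  ultimately show ?thesis using finS S(2)
    by (intro exI[of _ B] exI[of _ Q]) (auto simp: B_def)
qed

text \<open>
  The hypothesis \<open>onto\<close> parametrises the curve \<open>{x. F\<^sub>k x = 0 for k \<noteq> n}\<close> by its coordinate
  \<open>s = x\<^sub>n\<close>, with \<open>c s\<close> the point over \<open>s\<close>.  The parametrisation is an isometry, and so is \<open>F\<close>.  Hence
  \<open>h(s) = F\<^sub>n(c s)\<close> is an isometry of \<open>\<M>\<close>, to which \<open>algebraic_isometry_has_zero\<close> applies.
\<close>

lemma near_identity_zero_step:
  fixes F :: "('n::finite \<Rightarrow> 'v) \<Rightarrow> ('n \<Rightarrow> 'v)"
  assumes F: "near_identity F" and poly: "\<And>k. poly_fun D (\<lambda>x. F x k)"
    and onto: "\<And>w. w \<in> polydisc \<Longrightarrow> \<exists>x\<in>polydisc. (F x)(n := x n) = w"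
  shows "\<exists>x\<in>polydisc. \<forall>k. F x k = 0"
proof -
  define G where "G y = (F y)(n := y n)" for y
  have G_eq: "G = (\<lambda>y j. if j \<in> - {n} then F y j else y j)" by (auto simp: G_def fun_eq_iff)
  have G: "near_identity G" unfolding G_eq by (rule near_identity_restrict[OF F])
  have "\<exists>x\<in>polydisc. G x = (\<lambda>_. 0)(n := s)" if "s \<in> max_ideal" for s
    using onto[of "(\<lambda>_. 0)(n := s)"] that by (auto simp: polydisc_def G_def)
  then obtain c where c: "\<And>s. s \<in> max_ideal \<Longrightarrow> c s \<in> polydisc"
      "\<And>s. s \<in> max_ideal \<Longrightarrow> G (c s) = (\<lambda>_. 0)(n := s)" by metis
  have cn: "c s n = s" if "s \<in> max_ideal" for s
    using fun_cong[OF c(2)[OF that], of n] by (simp add: G_def)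
  have ck: "F (c s) k = 0" if "s \<in> max_ideal" "k \<noteq> n" for s k
    using fun_cong[OF c(2)[OF that(1)], of k] that by (simp add: G_def)
  have close: "(\<forall>k. Fin g \<le> val (c s k - c s' k)) \<longleftrightarrow> Fin g \<le> val (s - s')"
    if "s \<in> max_ideal" "s' \<in> max_ideal" for s s' g
    unfolding near_identity_isometry[OF G c(1)[OF that(1)] c(1)[OF that(2)], symmetric]
    using that by (auto simp: c(2))
  define h where "h s = F (c s) n" for s
  have maps: "h s \<in> max_ideal" if "s \<in> max_ideal" for s
    unfolding h_def by (rule polydiscD[OF near_identity_maps[OF F c(1)[OF that]]])
  have iso: "val (h s - h s') = val (s - s')" if s: "s \<in> max_ideal" "s' \<in> max_ideal" for s s'
  proof (rule eq_if_same_finite_lower_bounds)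
    fix g
    have "Fin g \<le> val (F (c s) k - F (c s') k)" if "k \<noteq> n" for k
      using that by (simp add: ck s)
    then have "(\<forall>k. Fin g \<le> val (F (c s) k - F (c s') k)) \<longleftrightarrow> Fin g \<le> val (h s - h s')"
      unfolding h_def by (metis (no_types))
    then show "Fin g \<le> val (h s - h s') \<longleftrightarrow> Fin g \<le> val (s - s')"
      unfolding near_identity_isometry[OF F c(1)[OF s(1)] c(1)[OF s(2)]] close[OF s] by (rule sym)
  qed (auto simp: val_not_Minf)
  have improve: "\<exists>s'\<in>max_ideal. val (h s) < val (h s')" if s: "s \<in> max_ideal" "h s \<noteq> 0" for s
  proof -
    \<comment> \<open>The Newton step, with the derivative of \<open>h\<close> replaced by \<open>1\<close>.\<close>
    define s' where "s' = s - h s"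
    have s': "s' \<in> max_ideal" unfolding s'_def by (intro max_ideal_diff s maps)
    obtain g where g: "val (h s) = Fin g" using val_Fin s(2) by blast
    have "\<forall>k. Fin g \<le> val (c s' k - c s k)"
      unfolding close[OF s' s(1)] using g by (simp add: s'_def val_minus)
    then have "Fin g < val ((F (c s') n - F (c s) n) - (c s' n - c s n))"
      by (intro near_identityD[OF F c(1)[OF s'] c(1)[OF s(1)]]) auto
    also have "(F (c s') n - F (c s) n) - (c s' n - c s n) = h s'"
      by (simp add: cn s s' h_def[symmetric]) (simp add: s'_def)
    finally show ?thesis using s' g by auto
  qed
  obtain B Q where B: "finite B" "B \<noteq> {}" "\<And>b. b \<in> B \<Longrightarrow> Q b \<noteq> 0" and
    rel: "\<And>x. x \<in> polydisc \<Longrightarrow> \<forall>k. k \<noteq> n \<longrightarrow> F x k = 0 \<Longrightarrow>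
      (\<Sum>b\<in>B. poly (Q b) (x n) * F x n ^ b) = 0"
    using plane_relation_on_curve[OF F poly onto] by blast
  have "(\<Sum>b\<in>B. poly (Q b) s * h s ^ b) = 0" if "s \<in> max_ideal" for s
    using rel[OF c(1)[OF that]] ck[OF that] by (simp add: cn that h_def)
  then obtain s where s: "s \<in> max_ideal" "h s = 0"
    using algebraic_isometry_has_zero[of h B Q] maps iso improve B by blast
  have "F (c s) k = 0" for k using ck s by (cases "k = n") (auto simp: h_def)
  then show ?thesis using c(1)[OF s(1)] by blast
qed

text \<open>
  Induction on the set of components of \<open>F\<close> that are switched on, the others being coordinate
  functions.  The empty set gives the identity map.
\<close>

lemma near_identity_onto:
  fixes F :: "('n::finite \<Rightarrow> 'v) \<Rightarrow> ('n \<Rightarrow> 'v)"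
  assumes F: "near_identity F" and poly: "\<And>k. poly_fun D (\<lambda>x. F x k)"
    and w: "w \<in> polydisc"
  shows "\<exists>x\<in>polydisc. F x = w"
proof -
  define R where "R I x k = (if k \<in> I then F x k else x k)" for I x k
  have R: "near_identity (R I)" for I
    unfolding R_def[abs_def] by (rule near_identity_restrict[OF F])
  have R_poly: "poly_fun (D + 1) (\<lambda>x. R I x k)" for I k
    using poly_fun_weaken[OF poly, of "D + 1"] poly_fun_weaken[OF poly_fun_coordinate, of "D + 1"]
    by (cases "k \<in> I") (simp_all add: R_def)
  have "\<forall>w\<in>polydisc. \<exists>x\<in>polydisc. R I x = w" for I
    using finite[of I]
  proof (induction I rule: finite_induct)
    case empty
    then show ?case by (auto simp: R_def[abs_def])
  next
    case (insert n I)
    show ?case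
    proof
      fix w :: "'n \<Rightarrow> 'v" assume w: "w \<in> polydisc"
      \<comment> \<open>Translation by \<open>w\<close> reduces a prescribed value to a zero.\<close>
      define H where "H x k = R (insert n I) x k - w k" for x k
      have "near_identity H"
        unfolding H_def[abs_def] by (rule near_identity_translate[OF R w])
      moreover have "poly_fun (D + 1) (\<lambda>x. H x k)" for k
        using poly_fun_add[OF R_poly poly_fun_const, of "insert n I" k "- w k"] by (simp add: H_def)
      moreover have "\<exists>x\<in>polydisc. (H x)(n := x n) = v" if v: "v \<in> polydisc" for v
      proof -
        \<comment> \<open>Component \<open>n\<close> of \<open>u\<close> is untranslated, because it prescribes \<open>x\<^sub>n\<close> and not a component of \<open>H\<close>.\<close>
        define u where "u = (\<lambda>k. v k + w k)(n := v n)"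
        have "u \<in> polydisc" using v w by (auto simp: u_def polydisc_def max_ideal_add)
        then obtain x where x: "x \<in> polydisc" "R I x = u" using insert.IH by blast
        have "(H x)(n := x n) = v"
        proof
          fix k
          show "((H x)(n := x n)) k = v k"
            using fun_cong[OF x(2), of k] insert.hyps
            by (cases "k = n") (auto simp: H_def R_def u_def split: if_splits)
        qed
        then show ?thesis using x(1) by blast
      qed
      ultimately obtain x where x: "x \<in> polydisc" "\<forall>k. H x k = 0"
        using near_identity_zero_step[of H "D + 1" n] by blast
      then have "R (insert n I) x = w" by (auto simp: H_def fun_eq_iff)
      then show "\<exists>x\<in>polydisc. R (insert n I) x = w" using x(1) by blast
    qed
  qed
  from this[of UNIV] have "\<exists>x\<in>polydisc. R UNIV x = w" using w by blast
  moreover have "R UNIV = F" by (simp add: R_def fun_eq_iff)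
  ultimately show ?thesis by simp
qed

section \<open>Integral systems with invertible linear part\<close>

lemma val_prod_integral: "(\<And>i. i \<in> A \<Longrightarrow> Fin 0 \<le> val (f i)) \<Longrightarrow> Fin 0 \<le> val (\<Prod>i\<in>A. f i)"
  by (induction A rule: infinite_finite_induct) (auto simp: val_1 intro: val_mult_integral)

lemma val_det_integral:
  fixes J :: "'v^'n^'n"
  assumes "\<And>i k. Fin 0 \<le> val (J $ i $ k)"
  shows "Fin 0 \<le> val (det J)"
  unfolding det_def
  by (intro val_sum_ge val_mult_integral val_prod_integral assms)
    (auto simp: sign_def val_1 val_minus)

text \<open>
  Cramer's rule expresses the entries of the inverse as integral determinants divided by a unit.
\<close>

lemma integral_inverse_matrix:
  fixes J :: "'v^'n^'n"
  assumes J: "\<And>i k. Fin 0 \<le> val (J $ i $ k)" and det: "val (det J) = Fin 0"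
  shows "\<exists>A. (\<forall>i k. Fin 0 \<le> val (A $ i $ k)) \<and> A ** J = mat 1 \<and> J ** A = mat 1"
proof -
  have nz: "det J \<noteq> 0" using det by auto
  define C where "C k j = (\<chi> i l. if l = k then (axis j 1 :: 'v^'n) $ i else J $ i $ l)" for k j
  define A where "A = (\<chi> k j. det (C k j) / det J)"
  have "Fin 0 \<le> val (A $ k $ j)" for k j
  proof -
    have "Fin 0 \<le> val (det (C k j))"
      by (rule val_det_integral) (auto simp: C_def axis_def val_1 J)
    also have "val (det (C k j)) = val (A $ k $ j * det J)" using nz by (simp add: A_def)
    also have "\<dots> = val (A $ k $ j)" by (cases "val (A $ k $ j)") (auto simp: val_mult det val_not_Minf)
    finally show ?thesis .
  qed
  moreover have "J ** A = mat 1"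
  proof -
    have "J *v (\<chi> k. A $ k $ j) = axis j 1" for j
      unfolding cramer[OF nz] by (simp add: A_def C_def)
    then have "(\<Sum>k\<in>UNIV. J $ i $ k * A $ k $ j) = (axis j 1 :: 'v^'n) $ i" for i j
      by (auto simp: matrix_vector_mult_def vec_eq_iff)
    then show ?thesis
      by (simp add: matrix_matrix_mult_def mat_def vec_eq_iff axis_def)
  qed
  ultimately show ?thesis using matrix_left_right_inverse by blast
qed

text \<open>
  Here \<open>l\<close> approximates \<open>u - v\<close> modulo \<open>{x. g < val x}\<close>; in the application it is the linear part
  of the difference of a monomial at two points whose distance has value at least \<open>g\<close>.  For \<open>u\<close> and \<open>v\<close> in \<open>1 + \<M>\<close>
  the Leibniz rule simplifies: approximations of factors add up to an approximation of the product.
\<close>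

definition first_order :: "'g \<Rightarrow> 'v \<Rightarrow> 'v \<Rightarrow> 'v \<Rightarrow> bool" where
  "first_order g u v l \<longleftrightarrow> u - 1 \<in> max_ideal \<and> v - 1 \<in> max_ideal \<and>
    Fin g \<le> val l \<and> Fin g < val (u - v - l)"

lemma first_order_one: "first_order g 1 1 0"
  by (simp add: first_order_def)

lemma first_order_mult:
  assumes "first_order g u v l" "first_order g u' v' l'"
  shows "first_order g (u * u') (v * v') (l + l')"
proof -
  have diff: "Fin g \<le> val (a - b)" if "first_order g a b c" for a b c
  proof -
    have "Fin g \<le> val ((a - b - c) + c)"
      using that by (intro val_add_ge) (auto simp: first_order_def)
    then show ?thesis by simp
  qed
  have "Fin (0 + g) < val ((u' - 1) * (u - v))" "Fin (0 + g) < val ((v - 1) * (u' - v'))"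
    using assms diff by (auto intro!: val_mult_gt simp only: first_order_def max_ideal_iff)
  then have "Fin g < val ((u - v - l) + (u' - v' - l') + ((u' - 1) * (u - v) + (v - 1) * (u' - v')))"
    using assms by (intro val_add_gt) (auto simp: first_order_def)
  also have "(u - v - l) + (u' - v' - l') + ((u' - 1) * (u - v) + (v - 1) * (u' - v')) =
      u * u' - v * v' - (l + l')"
    by (simp add: algebra_simps)
  finally show ?thesis
    using assms by (auto simp: first_order_def one_plus_mult val_add_ge)
qed

lemma first_order_power: "first_order g u v l \<Longrightarrow> first_order g (u ^ m) (v ^ m) (of_nat m * l)"
  by (induction m) (auto simp: first_order_one distrib_right intro: first_order_mult)

lemma first_order_prod:
  "(\<And>k. k \<in> A \<Longrightarrow> first_order g (u k) (v k) (l k)) \<Longrightarrow>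
    first_order g (\<Prod>k\<in>A. u k) (\<Prod>k\<in>A. v k) (\<Sum>k\<in>A. l k)"
  by (induction A rule: infinite_finite_induct) (auto intro: first_order_one first_order_mult)

lemma first_order_monomial:
  assumes "x \<in> polydisc" "y \<in> polydisc" "\<And>k. Fin g \<le> val (x k - y k)"
  shows "first_order g (\<Prod>k\<in>UNIV. (1 + x k) ^ e k) (\<Prod>k\<in>UNIV. (1 + y k) ^ e k)
    (\<Sum>k\<in>UNIV. of_nat (e k) * (x k - y k))"
  using assms by (intro first_order_prod first_order_power) (auto simp: first_order_def polydisc_def)

text \<open>
  \<open>J\<close> is the Jacobian matrix of \<open>H\<close> at \<open>0\<close>.  Multiplying \<open>H\<close> by \<open>J\<^sup>-\<^sup>1\<close>, which has integral entries, gives a map close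
  to the identity with the same zeros.
\<close>

lemma integral_system_unique_zero:
  fixes I :: "'n::finite \<Rightarrow> 'j set" and c :: "'n \<Rightarrow> 'j \<Rightarrow> 'v" and e :: "'n \<Rightarrow> 'j \<Rightarrow> 'n \<Rightarrow> nat"
  defines "H \<equiv> \<lambda>x i. \<Sum>j\<in>I i. c i j * (\<Prod>k\<in>UNIV. (1 + x k) ^ e i j k)"
    and "J \<equiv> \<chi> i k. \<Sum>j\<in>I i. c i j * of_nat (e i j k)"
  assumes fin: "\<And>i. finite (I i)"
    and integral: "\<And>i j. j \<in> I i \<Longrightarrow> Fin 0 \<le> val (c i j)"
    and root: "\<And>i. H (\<lambda>_. 0) i \<in> max_ideal"
    and det: "val (det J) = Fin 0"
  shows "\<exists>!x. x \<in> polydisc \<and> (\<forall>i. H x i = 0)"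
proof -
  have J: "Fin 0 \<le> val (J $ i $ k)" for i k
  proof -
    have "Fin 0 \<le> val (of_nat m)" for m by (cases m) (auto simp: val_of_nat simp del: of_nat_Suc)
    then show ?thesis unfolding J_def by (auto intro!: val_sum_ge val_mult_integral integral)
  qed
  obtain A where A: "\<And>i k. Fin 0 \<le> val (A $ i $ k)" "A ** J = mat 1" "J ** A = mat 1"
    using integral_inverse_matrix[OF J det] by blast
  have AJ: "(\<Sum>k\<in>UNIV. A $ i $ k * (\<Sum>l\<in>UNIV. J $ k $ l * z l)) = z i" for z i
  proof -
    have "A *v (J *v (\<chi> l. z l)) = (\<chi> l. z l)" by (simp add: matrix_vector_mul_assoc A(2))
    then show ?thesis by (simp add: matrix_vector_mult_def vec_eq_iff)
  qed
  have JA: "(\<Sum>k\<in>UNIV. J $ i $ k * (\<Sum>l\<in>UNIV. A $ k $ l * z l)) = z i" for z i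
  proof -
    have "J *v (A *v (\<chi> l. z l)) = (\<chi> l. z l)" by (simp add: matrix_vector_mul_assoc A(3))
    then show ?thesis by (simp add: matrix_vector_mult_def vec_eq_iff)
  qed
  define F where "F x i = (\<Sum>k\<in>UNIV. A $ i $ k * H x k)" for x i
  have F_zero: "F x = (\<lambda>_. 0) \<longleftrightarrow> (\<forall>i. H x i = 0)" for x
  proof
    assume "F x = (\<lambda>_. 0)"
    then show "\<forall>i. H x i = 0" using JA[of _ "H x"] by (simp add: F_def fun_eq_iff)
  qed (simp add: F_def fun_eq_iff)
  have H_maps: "H x i \<in> max_ideal" if x: "x \<in> polydisc" for x i
  proof -
    have "(\<Prod>k\<in>UNIV. (1 + x k) ^ e i j k) - 1 \<in> max_ideal" for j
      using first_order_monomial[OF x x, of 0] by (simp add: first_order_def)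
    then have "Fin 0 < val (\<Sum>j\<in>I i. ((\<Prod>k\<in>UNIV. (1 + x k) ^ e i j k) - 1) * c i j)"
      using val_mult_gt[of 0 _ 0] integral
      by (intro val_sum_gt) (auto simp: max_ideal_iff)
    moreover have "Fin 0 < val (\<Sum>j\<in>I i. c i j)"
      using root[of i] by (simp add: H_def max_ideal_iff)
    ultimately have "Fin 0 < val ((\<Sum>j\<in>I i. ((\<Prod>k\<in>UNIV. (1 + x k) ^ e i j k) - 1) * c i j) + (\<Sum>j\<in>I i. c i j))"
      by (rule val_add_gt)
    then show ?thesis
      by (simp add: H_def max_ideal_iff algebra_simps flip: sum.distrib)
  qed
  have H_diff: "Fin g < val (H x i - H y i - (\<Sum>k\<in>UNIV. J $ i $ k * (x k - y k)))"
    if xy: "x \<in> polydisc" "y \<in> polydisc" "\<And>k. Fin g \<le> val (x k - y k)" for x y g i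
  proof -
    define P where "P z j = (\<Prod>k\<in>UNIV. (1 + z k) ^ e i j k)" for z :: "'n \<Rightarrow> 'v" and j
    define L where "L j = (\<Sum>k\<in>UNIV. of_nat (e i j k) * (x k - y k))" for j
    have "Fin g < val (P x j - P y j - L j)" for j
      using first_order_monomial[OF xy, of "e i j"] by (simp add: first_order_def P_def L_def)
    then have "Fin g < val (\<Sum>j\<in>I i. (P x j - P y j - L j) * c i j)"
      using val_mult_gt[of g _ 0] integral by (intro val_sum_gt) auto
    moreover have "(\<Sum>k\<in>UNIV. J $ i $ k * (x k - y k)) = (\<Sum>j\<in>I i. L j * c i j)"
      unfolding J_def L_def by (simp add: sum_distrib_left sum_distrib_right mult_ac) (rule sum.swap)
    ultimately show ?thesis
      by (simp add: H_def P_def algebra_simps sum_subtractf sum.distrib)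
  qed
  have near: "near_identity F"
    unfolding near_identity_def
  proof (intro conjI ballI allI impI)
    fix x :: "'n \<Rightarrow> 'v" assume "x \<in> polydisc"
    then have "Fin (0 + 0) < val (H x k * A $ i $ k)" for i k
      using H_maps A(1) by (intro val_mult_gt) (auto simp: max_ideal_iff)
    then show "F x \<in> polydisc"
      by (auto simp: polydisc_def max_ideal_iff F_def mult.commute intro!: val_sum_gt)
  next
    fix x y :: "'n \<Rightarrow> 'v" and g i
    assume xy: "x \<in> polydisc" "y \<in> polydisc" "\<forall>k. Fin g \<le> val (x k - y k)"
    define R where "R k = H x k - H y k - (\<Sum>l\<in>UNIV. J $ k $ l * (x l - y l))" for k
    have "Fin (g + 0) < val (R k * A $ i $ k)" for k
      unfolding R_def using xy A(1) by (intro val_mult_gt H_diff) auto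
    then have "Fin g < val (\<Sum>k\<in>UNIV. A $ i $ k * R k)"
      by (intro val_sum_gt) (auto simp: mult.commute)
    also have "(\<Sum>k\<in>UNIV. A $ i $ k * R k) = F x i - F y i - (x i - y i)"
      using AJ[of i "\<lambda>l. x l - y l"]
      by (simp add: R_def F_def right_diff_distrib sum_subtractf)
    finally show "Fin g < val (F x i - F y i - (x i - y i))" .
  qed
  define D where "D = (\<Sum>i\<in>UNIV. \<Sum>j\<in>I i. \<Sum>k\<in>UNIV. e i j k * 1)"
  have "poly_fun D (\<lambda>x. F x i)" for i
    unfolding F_def H_def
  proof (intro poly_fun_sum poly_fun_scale)
    fix k j assume j: "j \<in> I k"
    have "poly_fun 1 (\<lambda>x. 1 + x l)" for l :: 'n
      by (intro poly_fun_add poly_fun_const poly_fun_coordinate)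
    then have "poly_fun (\<Sum>l\<in>UNIV. e k j l * 1) (\<lambda>x. \<Prod>l\<in>UNIV. ((1::'v) + x l) ^ e k j l)"
      by (intro poly_fun_prod poly_fun_power)
    moreover have "(\<Sum>l\<in>UNIV. e k j l * 1) \<le> D"
    proof -
      have "(\<Sum>l\<in>UNIV. e k j l * 1) \<le> (\<Sum>j\<in>I k. \<Sum>l\<in>UNIV. e k j l * 1)"
        using j fin by (intro member_le_sum) auto
      also have "\<dots> \<le> D" unfolding D_def by (intro member_le_sum) auto
      finally show ?thesis .
    qed
    ultimately show "poly_fun D (\<lambda>x. \<Prod>l\<in>UNIV. ((1::'v) + x l) ^ e k j l)"
      by (rule poly_fun_weaken)
  qed
  moreover have "(\<lambda>_. 0) \<in> polydisc" by (simp add: polydisc_def)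
  ultimately obtain x where x: "x \<in> polydisc" "F x = (\<lambda>_. 0)"
    using near_identity_onto[OF near] by blast
  show ?thesis
  proof (rule ex1I[of _ x])
    show "x \<in> polydisc \<and> (\<forall>i. H x i = 0)" using x F_zero by blast
    fix y assume "y \<in> polydisc \<and> (\<forall>i. H y i = 0)"
    then show "y = x" using near_identity_inj[OF near, of y x] x F_zero by metis
  qed
qed

section \<open>Lifting simple residue roots\<close>

lemma rv_coset_sym:
  assumes "x \<in> rv_coset val y" "y \<noteq> 0"
  shows "y \<in> rv_coset val x"
proof -
  obtain m where m: "m \<in> max_ideal" "x = y * (1 + m)" using assms by (auto simp: rv_coset_def)
  have nz: "1 + m \<noteq> 0" using val_one_plus[OF m(1)] by auto
  define m' where "m' = - m / (1 + m)"
  have "m = - (m' * (1 + m))" using nz by (simp add: m'_def)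
  then have "val m = val (m' * (1 + m))" using val_minus by metis
  also have "\<dots> = val m'"
    using val_one_plus[OF m(1)] by (cases "val m'") (auto simp: val_mult val_not_Minf)
  finally have "m' \<in> max_ideal" using m(1) by (simp add: max_ideal_iff)
  moreover have "y = x * (1 + m')" using nz by (simp add: m m'_def field_simps)
  ultimately show ?thesis by (auto simp: rv_coset_def)
qed

lemma rv_coset_subset: "x \<in> rv_coset val y \<Longrightarrow> rv_coset val x \<subseteq> rv_coset val y"
proof
  fix z assume "x \<in> rv_coset val y" "z \<in> rv_coset val x"
  then obtain m m' where m: "m \<in> max_ideal" "m' \<in> max_ideal" "z = y * ((1 + m) * (1 + m'))"
    by (auto simp: rv_coset_def mult.assoc)
  have "(1 + m) * (1 + m') - 1 \<in> max_ideal" using m by (intro one_plus_mult) auto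
  then show "z \<in> rv_coset val y" unfolding rv_coset_def m(3)
    by (intro CollectI exI[of _ "(1 + m) * (1 + m') - 1"]) simp
qed

lemma rv_eq_iff:
  assumes "b \<noteq> 0"
  shows "rv val a = rv val b \<longleftrightarrow> (\<exists>m\<in>max_ideal. a = b * (1 + m))"
proof
  assume "rv val a = rv val b"
  then have "a \<in> rv_coset val b"
    using assms self_in_rv_coset[of a] by (auto simp: rv_def split: if_splits)
  then show "\<exists>m\<in>max_ideal. a = b * (1 + m)" by (auto simp: rv_coset_def)
next
  assume "\<exists>m\<in>max_ideal. a = b * (1 + m)"
  then have a: "a \<in> rv_coset val b" by (auto simp: rv_coset_def)
  then have "a \<noteq> 0" using val_rv_coset[OF a] assms by (metis val_eq_Pinf_iff)
  moreover have "rv_coset val a = rv_coset val b"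
    using rv_coset_subset[OF a] rv_coset_subset[OF rv_coset_sym[OF a assms]] by blast
  ultimately show "rv val a = rv val b" using assms by (simp add: rv_def)
qed

text \<open>
  Evaluated on tuples of value \<open>\<gamma>\<close>, all terms of a \<open>\<gamma>\<close>-polynomial have value \<open>\<alpha>\<close>, so that division by an element
  of value \<open>\<alpha>\<close> makes them units.
\<close>

lemma gamma_poly_term_val:
  assumes F: "gamma_poly val \<gamma> \<alpha> F" and j: "j \<in> idx F" and b: "\<And>k. val (b k) = Fin (\<gamma> k)"
  shows "val (coef F j * (\<Prod>k\<in>UNIV. b k ^ expo F j k)) = Fin \<alpha>"
proof -
  have "val (\<Prod>k\<in>UNIV. b k ^ expo F j k) = Fin (\<Sum>k\<in>UNIV. \<Sum>l<expo F j k. \<gamma> k)"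
    by (rule val_prod) (rule val_power[OF b])
  moreover have "Fin \<alpha> = val (coef F j) + Fin (\<Sum>k\<in>UNIV. \<Sum>l<expo F j k. \<gamma> k)"
    using F j by (simp add: gamma_poly_def)
  ultimately show ?thesis by (simp add: val_mult)
qed

text \<open>
  The logarithmic derivative multiplies each monomial by its exponent.  In this form the Jacobian in the
  multiplicative coordinates \<open>b\<^sub>k (1 + x\<^sub>k)\<close> is compared with \<open>jacobian_det_ms\<close>.
\<close>

lemma coordinate_times_partial_ms:
  fixes F :: "('j, 'n::finite, 'v) monosum"
  assumes "finite (idx F)"
  shows "b k * eval_ms (partial_ms k F) b =
    (\<Sum>j\<in>idx F. coef F j * (\<Prod>l\<in>UNIV. b l ^ expo F j l) * of_nat (expo F j k))"
proof -
  have "b k * (\<Prod>l\<in>UNIV. b l ^ ((expo F j)(k := expo F j k - 1)) l) = (\<Prod>l\<in>UNIV. b l ^ expo F j l)"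
    if "expo F j k \<noteq> 0" for j
  proof -
    have "(\<Prod>l\<in>UNIV. b l ^ f l) = b k ^ f k * (\<Prod>l\<in>UNIV - {k}. b l ^ f l)" for f :: "'n \<Rightarrow> nat"
      by (rule prod.remove) auto
    moreover have "b k * b k ^ (expo F j k - 1) = b k ^ expo F j k"
      using that by (cases "expo F j k") auto
    ultimately show ?thesis by (simp add: mult.assoc[symmetric])
  qed
  then show ?thesis
    unfolding eval_ms_def sum_distrib_left
    by (intro sum.mono_neutral_cong_left) (auto simp: partial_ms_def assms mult_ac)
qed

text \<open>
  The Jacobian matrix \<open>J\<close> of the normalised system has entries \<open>d\<^sub>i\<^sup>-\<^sup>1 b\<^sub>k \<partial>F\<^sub>i/\<partial>X\<^sub>k(b)\<close> with \<open>val d\<^sub>i = \<alpha>\<^sub>i\<close>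
  and \<open>val b\<^sub>k = \<gamma>\<^sub>k\<close>.  Its determinant thus has value \<open>0\<close> exactly if \<open>jacobian_det_ms F\<close> has value
  \<open>\<Sum>\<^sub>i \<alpha>\<^sub>i - \<Sum>\<^sub>i \<gamma>\<^sub>i\<close> at \<open>b\<close>, which is what simplicity gives.
\<close>

lemma unique_lift_of_simple_residue_root:
  fixes F :: "'n::finite \<Rightarrow> ('j, 'n, 'v) monosum"
  assumes F: "\<And>i. gamma_poly val \<gamma> (\<alpha> i) (F i)"
    and simple: "simple_common_residue_root val \<gamma> \<alpha> F t"
  shows "\<exists>!a. a \<in> rv_preimage val t \<and> (\<forall>i. eval_ms (F i) a = 0)"
proof -
  have root: "residue_root val \<gamma> (\<alpha> i) (F i) t" for i
    using simple by (simp add: simple_common_residue_root_def)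
  have t: "t i \<in> RV val" "vrv val (t i) = Fin (\<gamma> i)" for i
    using root[of i] by (auto simp: residue_root_def)
  obtain b where b: "b \<in> rv_preimage val t"
    using root[of undefined] by (auto simp: residue_root_def)
  have bt: "rv val (b k) = t k" for k using b by (simp add: rv_preimage_def)
  have vb: "val (b k) = Fin (\<gamma> k)" for k using bt t(2) vrv_rv by metis
  then have b_nz: "b k \<noteq> 0" for k by (metis extended.distinct(1) val_0)
  have small: "Fin (\<alpha> i) < val (eval_ms (F i) b)" for i
    using root[of i] residue_root_indep[OF F t(2) _ b] by (auto simp: residue_root_def)
  have jac: "\<not> Fin ((\<Sum>i\<in>UNIV. \<alpha> i) - (\<Sum>i\<in>UNIV. \<gamma> i)) < val (eval_ms (jacobian_det_ms F) b)"
    using simple t b by (auto simp: simple_common_residue_root_def residue_root_def)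
  have "\<forall>i. \<exists>x. val x = Fin (\<alpha> i)" using val_surj by blast
  then obtain d where vd: "\<And>i. val (d i) = Fin (\<alpha> i)" by metis
  then have d_nz: "d i \<noteq> 0" for i by (metis extended.distinct(1) val_0)
  define c where "c i j = coef (F i) j * (\<Prod>k\<in>UNIV. b k ^ expo (F i) j k) / d i" for i j
  have dc: "d i * c i j = coef (F i) j * (\<Prod>k\<in>UNIV. b k ^ expo (F i) j k)" for i j
    using d_nz by (simp add: c_def)
  define H where "H x i = (\<Sum>j\<in>idx (F i). c i j * (\<Prod>k\<in>UNIV. (1 + x k) ^ expo (F i) j k))" for x i
  have eval: "eval_ms (F i) (\<lambda>k. b k * (1 + x k)) = d i * H x i" for x i
    unfolding H_def eval_ms_def sum_distrib_left mult.assoc[symmetric] dc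
    by (simp add: power_mult_distrib prod.distrib mult.assoc)
  define J where "J = (\<chi> i k. \<Sum>j\<in>idx (F i). c i j * of_nat (expo (F i) j k))"
  have fin: "finite (idx (F i))" for i using F[of i] by (simp add: gamma_poly_def)
  have c: "Fin 0 \<le> val (c i j)" if "j \<in> idx (F i)" for i j
    using gamma_poly_term_val[OF F that vb] vd[of i] unfolding dc[symmetric]
    by (cases "val (c i j)") (auto simp: val_mult)
  have "val (det J) = Fin 0"
  proof -
    have "Fin 0 \<le> val (of_nat m)" for m by (cases m) (auto simp: val_of_nat simp del: of_nat_Suc)
    then have int: "Fin 0 \<le> val (det J)"
      by (intro val_det_integral) (auto simp: J_def intro!: val_sum_ge val_mult_integral c)
    define E where "E i k = eval_ms (partial_ms k (F i)) b" for i k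
    have "J $ i $ k = inverse (d i) * b k * E i k" for i k
      unfolding E_def mult.assoc coordinate_times_partial_ms[OF fin]
      by (simp add: J_def c_def sum_distrib_left field_simps)
    then have "J = (\<chi> i k. inverse (d i) * b k * E i k)" by (simp add: vec_eq_iff)
    then have "det J = (\<Prod>i\<in>UNIV. inverse (d i)) * (\<Prod>k\<in>UNIV. b k) * det (\<chi> i k. E i k)"
      by (simp only: det_scale_rows_columns)
    moreover have "(\<Prod>i\<in>UNIV. d i) * (\<Prod>i\<in>UNIV. inverse (d i)) = 1"
      by (simp add: d_nz flip: prod.distrib)
    ultimately have "(\<Prod>i\<in>UNIV. d i) * det J = (\<Prod>k\<in>UNIV. b k) * det (\<chi> i k. E i k)"
      by (simp add: mult.assoc[symmetric])
    also have "det (\<chi> i k. E i k) = eval_ms (jacobian_det_ms F) b"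
      unfolding jacobian_det_ms_def E_def
      by (rule eval_det_ms[symmetric]) (simp add: partial_ms_def fin)
    finally have eq: "Fin (\<Sum>i\<in>UNIV. \<alpha> i) + val (det J) =
        Fin (\<Sum>i\<in>UNIV. \<gamma> i) + val (eval_ms (jacobian_det_ms F) b)"
      using val_prod[of UNIV d, OF vd] val_prod[of UNIV b, OF vb] by (metis val_mult)
    have "\<not> Fin 0 < val (det J)"
    proof
      assume "Fin 0 < val (det J)"
      then show False using eq jac
        by (cases "val (det J)"; cases "val (eval_ms (jacobian_det_ms F) b)")
          (auto simp: algebra_simps, metis less_add_same_cancel2)
    qed
    then show ?thesis using int by simp
  qed
  moreover have "H (\<lambda>_. 0) i \<in> max_ideal" for i
    using small[of i] eval[of i "\<lambda>_. 0"] vd[of i]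
    by (cases "val (H (\<lambda>_. 0) i)") (auto simp: val_mult max_ideal_iff val_not_Minf)
  ultimately have "\<exists>!x. x \<in> polydisc \<and> (\<forall>i. H x i = 0)"
    using integral_system_unique_zero[of "\<lambda>i. idx (F i)" c "\<lambda>i. expo (F i)"] fin c
    unfolding H_def J_def by blast
  then obtain x where x: "x \<in> polydisc" "\<forall>i. H x i = 0"
    and uniq: "\<And>y. y \<in> polydisc \<Longrightarrow> \<forall>i. H y i = 0 \<Longrightarrow> y = x" by blast
  show ?thesis
  proof (rule ex1I[of _ "\<lambda>k. b k * (1 + x k)"])
    have "rv val (b k * (1 + x k)) = t k" for k
      using rv_eq_iff[OF b_nz, of "b k * (1 + x k)" k] polydiscD[OF x(1), of k] bt by auto
    then show "(\<lambda>k. b k * (1 + x k)) \<in> rv_preimage val t \<and>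
        (\<forall>i. eval_ms (F i) (\<lambda>k. b k * (1 + x k)) = 0)"
      using x(2) by (simp add: rv_preimage_def eval)
  next
    fix a assume a: "a \<in> rv_preimage val t \<and> (\<forall>i. eval_ms (F i) a = 0)"
    then have "rv val (a k) = rv val (b k)" for k by (simp add: rv_preimage_def bt)
    then have "\<exists>m\<in>max_ideal. a k = b k * (1 + m)" for k
      using rv_eq_iff[OF b_nz] by blast
    then obtain y where y: "\<And>k. y k \<in> max_ideal" "\<And>k. a k = b k * (1 + y k)" by metis
    have a_eq: "a = (\<lambda>k. b k * (1 + y k))" using y(2) by (simp add: fun_eq_iff)
    have "\<forall>i. H y i = 0" using a eval[of _ y] d_nz unfolding a_eq by simp
    then have "y = x" using y(1) by (intro uniq) (simp add: polydisc_def)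
    then show "a = (\<lambda>k. b k * (1 + x k))" using a_eq by simp
  qed
qed

end

theorem lemma7p2:
  fixes val :: "'v::alg_closed_field \<Rightarrow> 'g::linordered_ab_group_add extended"
    and \<gamma> \<alpha> :: "'n::finite \<Rightarrow> 'g"
    and F :: "'n \<Rightarrow> ('j, 'n, 'v) monosum"
    and t :: "'n \<Rightarrow> 'v rv"
  assumes "acvf val"
    and "\<And>i. gamma_poly val \<gamma> (\<alpha> i) (F i)"
    and "simple_common_residue_root val \<gamma> \<alpha> F t"
  shows "\<exists>!a. a \<in> rv_preimage val t \<and> (\<forall>i. eval_ms (F i) a = 0)"
  by (rule acvf.unique_lift_of_simple_residue_root[OF assms])

end
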